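(* Let $B$ be a reflexive (closed linear) subspace of $L_1=L_1[0,1]$ and let $\mathfrak{m}(B)$ be its boundary space. Then the fundamental function of $\mathfrak{m}(B)$ is given, for $\tau\in(0,1]$, by $$\varphi_{\mathfrak{m}(B)}(\tau)=\eta^{\star}(B,\tau)=\sup_{0<h\le\tau}\{h/\eta(B,\tau)\}.$$
   Context: A symmetric space is a Banach space $E$ of (classes of a.e. equal) Lebesgue measurable real-valued functions on $[0,1]$ such that: (1) if $x\in E$ and $|y(t)|\le|x(t)|$ a.e. then $y\in E$ and $\|y\|_E\le\|x\|_E$; (2) if $x\in E$ and $|y|$ and $|x|$ are equimeasurable, then $y\in E$ and $\|y\|_E=\|x\|_E$. The fundamental function of $E$ is $\varphi_E(\tau)=\|\chi_{[0,\tau]}\|_E$. Throughout, every symmetric space is normalized by $\varphi_E(1)=1$; then $L_\infty\subseteq E\subseteq L_1$ with both inclusions of norm at most $1$. For a subspace $B\neq\{0\}$ of $L_1$ and $\varepsilon>0$, $$\eta(B,\varepsilon)=\sup\{\sup\{\|x\chi_e\|_{L_1}:\operatorname{mes}(e)=\varepsilon\}:x\in B,\ \|x\|_{L_1}=1\},\qquad \eta(B,0)=0,$$ where $e$ ranges over measurable subsets of $[0,1]$ and $\operatorname{mes}$ is Lebesgue measure. $B$ can be transferred into a symmetric space $E$ if $B\subseteq E$ and there is $c\in[1,\infty)$ with $c^{-1}\|x\|_{L_1}\le\|x\|_E\le c\|x\|_{L_1}$ for all $x\in B$. $T(B)$ is the class of all symmetric spaces $E$ into which $B$ can be transferred. For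 $E\in T(B)$ let $c_E$ be the least constant with $\|x\|_E\le c_E\|x\|_{L_1}$ for all $x\in B$, and put $|||x|||_E=\max\{\|x\|_{L_1},\,c_E^{-1}\|x\|_E\}$ for $x\in E$ (an equivalent symmetric norm on $E$). The boundary space $\mathfrak{m}(B)$ consists of all functions $x$ belonging to every $E\in T(B)$ with $\|x\|_{\mathfrak{m}(B)}=\sup\{|||x|||_E:E\in T(B)\}<\infty$, with this norm. *)

theory Defs
  imports "HOL-Analysis.Analysis"
begin

text \<open>Classes of a.e. equal functions are represented by their members: a space of classes is a
  set of functions that is closed under a.e. equality. Functions have type
  \<^typ>\<open>real \<Rightarrow> real\<close>, but only their values on the unit interval matter.\<close>

abbreviation unit_leb :: "real measure" where
  "unit_leb \<equiv> lebesgue_on {0..1}"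

definition L1_space :: "(real \<Rightarrow> real) set" where
  "L1_space = {x. integrable unit_leb x}"

definition L1_norm :: "(real \<Rightarrow> real) \<Rightarrow> real" where
  "L1_norm x = (LINT t|unit_leb. \<bar>x t\<bar>)"

definition linear_function_space :: "('a \<Rightarrow> real) set \<Rightarrow> bool" where
  "linear_function_space X \<longleftrightarrow>
     (\<lambda>t. 0) \<in> X \<and>
     (\<forall>x\<in>X. \<forall>y\<in>X. (\<lambda>t. x t + y t) \<in> X) \<and>
     (\<forall>x\<in>X. \<forall>a. (\<lambda>t. a * x t) \<in> X)"

text \<open>The value 0 outside of \<^term>\<open>X\<close> makes a functional on \<^term>\<open>X\<close> a unique object. The dual
  is again a set of real-valued functions, so that it has a dual itself. If \<^term>\<open>N\<close> is only
  a seminorm on functions, boundedness makes functionals invariant under changing the argument by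
  a function of seminorm 0.\<close>

definition dual_space ::
    "('a \<Rightarrow> real) set \<Rightarrow> (('a \<Rightarrow> real) \<Rightarrow> real) \<Rightarrow> (('a \<Rightarrow> real) \<Rightarrow> real) set" where
  "dual_space X N = {f.
     (\<forall>x\<in>X. \<forall>y\<in>X. f (\<lambda>t. x t + y t) = f x + f y) \<and>
     (\<forall>x\<in>X. \<forall>a. f (\<lambda>t. a * x t) = a * f x) \<and>
     (\<exists>C. \<forall>x\<in>X. \<bar>f x\<bar> \<le> C * N x) \<and>
     (\<forall>x. x \<notin> X \<longrightarrow> f x = 0)}"

definition dual_norm ::
    "('a \<Rightarrow> real) set \<Rightarrow> (('a \<Rightarrow> real) \<Rightarrow> real) \<Rightarrow> (('a \<Rightarrow> real) \<Rightarrow> real) \<Rightarrow> real" where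
  "dual_norm X N f = (SUP x\<in>{x\<in>X. N x \<le> 1}. \<bar>f x\<bar>)"

definition reflexive_space :: "('a \<Rightarrow> real) set \<Rightarrow> (('a \<Rightarrow> real) \<Rightarrow> real) \<Rightarrow> bool" where
  "reflexive_space X N \<longleftrightarrow>
     (\<forall>\<Phi> \<in> dual_space (dual_space X N) (dual_norm X N).
        \<exists>x\<in>X. \<forall>f \<in> dual_space X N. \<Phi> f = f x)"

text \<open>Closedness is with respect to the \<^const>\<open>L1_norm\<close>; it includes closedness under a.e.
  equality (take a constant sequence).\<close>

definition closed_subspace_L1 :: "(real \<Rightarrow> real) set \<Rightarrow> bool" where
  "closed_subspace_L1 B \<longleftrightarrow>
     B \<subseteq> L1_space \<and> linear_function_space B \<and>
     (\<forall>X x. (\<forall>n. X n \<in> B) \<and> x \<in> L1_space \<and>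
        (\<lambda>n::nat. L1_norm (\<lambda>t. X n t - x t)) \<longlonglongrightarrow> 0 \<longrightarrow> x \<in> B)"

type_synonym fun_space = "(real \<Rightarrow> real) set \<times> ((real \<Rightarrow> real) \<Rightarrow> real)"

definition banach_function_space :: "fun_space \<Rightarrow> bool" where
  "banach_function_space = (\<lambda>(E, N).
     E \<subseteq> borel_measurable unit_leb \<and> linear_function_space E \<and>
     (\<forall>x\<in>E. 0 \<le> N x) \<and>
     (\<forall>x\<in>E. N x = 0 \<longleftrightarrow> (AE t in unit_leb. x t = 0)) \<and>
     (\<forall>x\<in>E. \<forall>a. N (\<lambda>t. a * x t) = \<bar>a\<bar> * N x) \<and>
     (\<forall>x\<in>E. \<forall>y\<in>E. N (\<lambda>t. x t + y t) \<le> N x + N y) \<and>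
     (\<forall>X. (\<forall>n. X n \<in> E) \<and>
        (\<forall>e>0. \<exists>K::nat. \<forall>m\<ge>K. \<forall>n\<ge>K. N (\<lambda>t. X m t - X n t) < e) \<longrightarrow>
        (\<exists>x\<in>E. (\<lambda>n. N (\<lambda>t. X n t - x t)) \<longlonglongrightarrow> 0)))"

definition abs_equimeasurable :: "(real \<Rightarrow> real) \<Rightarrow> (real \<Rightarrow> real) \<Rightarrow> bool" where
  "abs_equimeasurable x y \<longleftrightarrow>
     (\<forall>s. measure unit_leb {t\<in>{0..1}. \<bar>x t\<bar> > s} = measure unit_leb {t\<in>{0..1}. \<bar>y t\<bar> > s})"

definition fundamental_function :: "fun_space \<Rightarrow> real \<Rightarrow> real" where
  "fundamental_function S \<tau> = snd S (indicator {0..\<tau>})"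

text \<open>The normalization includes membership of the indicator, because the norm component is
  unconstrained outside of the space.\<close>

definition symmetric_space :: "fun_space \<Rightarrow> bool" where
  "symmetric_space = (\<lambda>(E, N).
     banach_function_space (E, N) \<and>
     (\<forall>x\<in>E. \<forall>y\<in>borel_measurable unit_leb.
        (AE t in unit_leb. \<bar>y t\<bar> \<le> \<bar>x t\<bar>) \<longrightarrow> y \<in> E \<and> N y \<le> N x) \<and>
     (\<forall>x\<in>E. \<forall>y\<in>borel_measurable unit_leb.
        abs_equimeasurable y x \<longrightarrow> y \<in> E \<and> N y = N x) \<and>
     indicator {0..1} \<in> E \<and> fundamental_function (E, N) 1 = 1)"

definition eta :: "(real \<Rightarrow> real) set \<Rightarrow> real \<Rightarrow> real" where
  "eta B \<epsilon> = (if \<epsilon> = 0 then 0 else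
     (SUP x\<in>{x\<in>B. L1_norm x = 1}.
        SUP e\<in>{e\<in>sets unit_leb. measure unit_leb e = \<epsilon>}. L1_norm (\<lambda>t. x t * indicator e t)))"

definition eta_star :: "(real \<Rightarrow> real) set \<Rightarrow> real \<Rightarrow> real" where
  "eta_star B \<tau> = (SUP h\<in>{0<..\<tau>}. h / eta B h)"

definition can_transfer :: "(real \<Rightarrow> real) set \<Rightarrow> fun_space \<Rightarrow> bool" where
  "can_transfer B = (\<lambda>(E, N).
     B \<subseteq> E \<and> (\<exists>c\<ge>1. \<forall>x\<in>B. inverse c * L1_norm x \<le> N x \<and> N x \<le> c * L1_norm x))"

definition transfer_class :: "(real \<Rightarrow> real) set \<Rightarrow> fun_space set" where
  "transfer_class B = {S. symmetric_space S \<and> can_transfer B S}"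

definition transfer_const :: "(real \<Rightarrow> real) set \<Rightarrow> fun_space \<Rightarrow> real" where
  "transfer_const B S = (LEAST c. \<forall>x\<in>B. snd S x \<le> c * L1_norm x)"

definition triple_norm :: "(real \<Rightarrow> real) set \<Rightarrow> fun_space \<Rightarrow> (real \<Rightarrow> real) \<Rightarrow> real" where
  "triple_norm B S x = max (L1_norm x) (inverse (transfer_const B S) * snd S x)"

definition boundary_space :: "(real \<Rightarrow> real) set \<Rightarrow> fun_space" where
  "boundary_space B =
     ({x. (\<forall>S\<in>transfer_class B. x \<in> fst S) \<and>
          bdd_above ((\<lambda>S. triple_norm B S x) ` transfer_class B)},
      \<lambda>x. SUP S\<in>transfer_class B. triple_norm B S x)"

end

theory Submission
  imports Defs "HOL-Probability.Distribution_Functions"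
begin

text \<open>If \<open>E\<close> is symmetric with fundamental function \<open>\<phi>\<close> and \<open>e\<close> has measure \<open>\<tau>\<close>, then replacing \<open>\<bar>x\<bar>\<close> by
  its mean over \<open>e\<close> does not increase the norm, i.e. \<open>\<phi> \<tau> * (LINT t:e. \<bar>x t\<bar>) \<le> \<tau> * \<parallel>x\<parallel>\<close>. For a step function
  with steps of equal length the mean is the average of its cyclic permutations, which are
  equimeasurable; the general case follows by approximation from below. Taking the supremum
  over the unit sphere of \<open>B\<close> gives \<open>\<phi> \<tau> / c\<^sub>E \<le> \<tau> / eta B \<tau>\<close> for every \<open>E\<close> in the transfer class.

  Conversely, the Marcinkiewicz space with norm \<open>sup (LINT t:e. \<bar>x t\<bar>) / eta B (mes e)\<close> over all \<open>e\<close> induces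
  the \<open>L\<^sub>1\<close> norm on \<open>B\<close>, so it lies in the transfer class with constant 1, and the indicator of
  \<open>{0..\<tau>}\<close> has norm at least \<open>\<tau> / eta B \<tau>\<close> there. Finally \<open>h / eta B h\<close> is nondecreasing, so both
  suprema of the statement are attained at \<open>h = \<tau>\<close>.\<close>

subsection \<open>Sets of prescribed measure\<close>

interpretation unit_leb: prob_space unit_leb
  by (rule prob_spaceI) (simp add: emeasure_restrict_space space_restrict_space)

lemma measure_unit_leb_interval:
  assumes "0 \<le> a" "a \<le> b" "b \<le> 1"
  shows "measure unit_leb {a..b} = b - a"
  using assms by (subst measure_restrict_space) auto

lemma interval_in_sets_unit_leb [measurable]:
  assumes "0 \<le> a" "b \<le> 1"
  shows "{a..b::real} \<in> sets unit_leb"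
  using assms by (auto simp: sets_restrict_space_iff)

lemma unit_interval_measure: "{0..1} \<in> sets unit_leb" "measure unit_leb {0..1} = 1"
  by (auto simp: interval_in_sets_unit_leb measure_unit_leb_interval)

lemma sets_of_measure_nonempty:
  assumes "0 \<le> h" "h \<le> 1"
  shows "{e\<in>sets unit_leb. measure unit_leb e = h} \<noteq> {}"
proof -
  have "{0..h} \<in> sets unit_leb" "measure unit_leb {0..h} = h"
    using assms by (auto simp: interval_in_sets_unit_leb measure_unit_leb_interval)
  then show ?thesis by blast
qed

lemma sets_unit_leb_subset: "e \<in> sets unit_leb \<Longrightarrow> e \<subseteq> {0..1}"
  using sets.sets_into_space[of e unit_leb] by (simp add: space_restrict_space)

text \<open>Lebesgue measure has no atoms: the measure of \<open>A \<inter> {0..u}\<close> is a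
  1-Lipschitz function of \<open>u\<close>, so the intermediate value theorem yields a cut point
  with the prescribed value.\<close>

lemma unit_leb_subset_of_measure:
  assumes A: "A \<in> sets unit_leb" and h: "0 \<le> h" "h \<le> measure unit_leb A"
  obtains C where "C \<in> sets unit_leb" "C \<subseteq> A" "measure unit_leb C = h"
proof -
  define g where "g u = measure unit_leb (A \<inter> {0..u})" for u
  have sub: "A \<subseteq> {0..1}" using A by (rule sets_unit_leb_subset)
  have meas: "A \<inter> {0..u} \<in> sets unit_leb" if "u \<le> 1" for u
    using A that by (intro sets.Int interval_in_sets_unit_leb) auto
  have step: "g u \<le> g v \<and> g v \<le> g u + (v - u)" if "0 \<le> u" "u \<le> v" "v \<le> 1" for u v
  proof
    show "g u \<le> g v" unfolding g_def
      using that meas by (intro unit_leb.finite_measure_mono) auto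
    have "g v \<le> measure unit_leb (A \<inter> {0..u} \<union> {u..v})" unfolding g_def
      using that meas[of u] by (intro unit_leb.finite_measure_mono sets.Un) auto
    also have "\<dots> \<le> g u + measure unit_leb {u..v}" unfolding g_def
      using that meas[of u] by (intro measure_Un_le) auto
    finally show "g v \<le> g u + (v - u)" using that by (simp add: measure_unit_leb_interval)
  qed
  have "1-lipschitz_on {0..1} g"
  proof (rule lipschitz_onI)
    fix u v :: real assume "u \<in> {0..1}" "v \<in> {0..1}"
    then show "dist (g u) (g v) \<le> 1 * dist u v"
      using step[of u v] step[of v u] by (cases "u \<le> v") (auto simp: dist_real_def)
  qed simp
  then have cont: "continuous_on {0..1} g" by (rule lipschitz_on_continuous_on)
  have "g 0 \<le> measure unit_leb {0..0}" unfolding g_def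
    by (intro unit_leb.finite_measure_mono interval_in_sets_unit_leb) auto
  then have "g 0 \<le> h" using h measure_unit_leb_interval[of 0 0] by simp
  moreover have "g 1 = measure unit_leb A" using sub by (simp add: g_def Int_absorb2)
  ultimately obtain u where "0 \<le> u" "u \<le> 1" "g u = h"
    using IVT'[of g 0 h 1] h cont by auto
  then show thesis using that[of "A \<inter> {0..u}"] meas by (auto simp: g_def)
qed

text \<open>The set \<open>e'\<close> collects the largest values of \<open>f\<close> on
  \<open>e\<close>. The level \<open>s\<close> is chosen with \<open>{f > s}\<close> of measure at
  most \<open>h\<close> and \<open>{f \<ge> s}\<close> of measure at least \<open>h\<close>; part of
  the plateau \<open>{f = s}\<close> then makes up the difference.\<close>

lemma unit_leb_threshold_set:
  fixes f :: "real \<Rightarrow> real"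
  assumes f [measurable]: "f \<in> borel_measurable unit_leb" and nonneg: "\<And>t. 0 \<le> f t"
    and e [measurable]: "e \<in> sets unit_leb" and h: "0 < h" "h \<le> measure unit_leb e"
  obtains s e' where "0 \<le> s" "e' \<in> sets unit_leb" "e' \<subseteq> e" "measure unit_leb e' = h"
    "\<And>t. t \<in> e' \<Longrightarrow> s \<le> f t" "\<And>t. t \<in> e - e' \<Longrightarrow> f t \<le> s"
proof -
  let ?m = "measure unit_leb"
  have e_sp: "e \<subseteq> space unit_leb" using e by (rule sets.sets_into_space)
  have gt_eq: "{t\<in>e. s < f t} = e \<inter> {t\<in>space unit_leb. s < f t}" for s
    using e_sp by auto
  have ge_eq: "{t\<in>e. s \<le> f t} = e \<inter> {t\<in>space unit_leb. s \<le> f t}" for s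
    using e_sp by auto
  have gt_sets: "{t\<in>e. s < f t} \<in> sets unit_leb" for s unfolding gt_eq by measurable
  have ge_sets: "{t\<in>e. s \<le> f t} \<in> sets unit_leb" for s unfolding ge_eq by measurable
  have gt_mono: "{t\<in>e. r < f t} \<subseteq> {t\<in>e. q < f t}" if "q \<le> r" for q r
    using that by auto
  define Q where "Q = {s. 0 \<le> s \<and> ?m {t\<in>e. s < f t} \<le> h}"
  define s where "s = Inf Q"
  \<comment> \<open>As \<open>f\<close> takes finite values, its superlevel sets shrink to the empty
    set; hence large levels belong to \<open>Q\<close>.\<close>
  have "(\<lambda>n. ?m {t\<in>e. real n < f t}) \<longlonglongrightarrow> ?m (\<Inter>n. {t\<in>e. real n < f t})"
    by (rule unit_leb.finite_Lim_measure_decseq) (auto simp: decseq_def intro: gt_sets)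
  moreover have "(\<Inter>n. {t\<in>e. real n < f t}) = {}"
    by (auto simp: not_less) (meson less_asym reals_Archimedean2)
  ultimately have "(\<lambda>n. ?m {t\<in>e. real n < f t}) \<longlonglongrightarrow> 0" by simp
  then have "eventually (\<lambda>n. ?m {t\<in>e. real n < f t} < h) sequentially"
    using h by (intro order_tendstoD(2)[of _ 0]) auto
  then obtain n where "?m {t\<in>e. real n < f t} < h"
    by (auto simp: eventually_sequentially)
  then have "real n \<in> Q" by (auto simp: Q_def)
  then have Q_ne: "Q \<noteq> {}" by auto
  have Q_bdd: "bdd_below Q" by (auto simp: Q_def intro!: bdd_belowI[of _ 0])
  have s0: "0 \<le> s" unfolding s_def using Q_ne by (intro cInf_greatest) (auto simp: Q_def)
  have above: "?m {t\<in>e. s + r < f t} \<le> h" if r: "0 < r" for r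
  proof -
    obtain q where q: "q \<in> Q" "q < s + r"
      using cInf_lessD[OF Q_ne, of "s + r"] r by (auto simp: s_def)
    have "?m {t\<in>e. s + r < f t} \<le> ?m {t\<in>e. q < f t}"
      using q gt_sets by (intro unit_leb.finite_measure_mono) auto
    then show ?thesis using q by (auto simp: Q_def)
  qed
  \<comment> \<open>Continuity from below along levels decreasing to \<open>s\<close> shows that the
    bound defining \<open>Q\<close> holds at the infimum itself.\<close>
  have "(\<lambda>n. ?m {t\<in>e. s + 1 / real (Suc n) < f t}) \<longlonglongrightarrow> ?m (\<Union>n. {t\<in>e. s + 1 / real (Suc n) < f t})"
    using gt_mono by (intro unit_leb.finite_Lim_measure_incseq) (auto simp: incseq_def frac_le intro: gt_sets)
  moreover have "(\<Union>n. {t\<in>e. s + 1 / real (Suc n) < f t}) = {t\<in>e. s < f t}"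
  proof (intro equalityI subsetI)
    fix t assume t: "t \<in> {t\<in>e. s < f t}"
    then obtain n where "inverse (real (Suc n)) < f t - s"
      using reals_Archimedean[of "f t - s"] by auto
    then show "t \<in> (\<Union>n. {t\<in>e. s + 1 / real (Suc n) < f t})"
      using t by (auto simp: inverse_eq_divide intro!: exI[of _ n])
  qed (auto intro: less_trans[rotated] simp: less_trans[of s "s + _"])
  moreover have "?m {t\<in>e. s + 1 / real (Suc n) < f t} \<le> h" for n by (rule above) simp
  ultimately have gt_le: "?m {t\<in>e. s < f t} \<le> h"
    by (metis (no_types, lifting) LIMSEQ_le_const2)
  have ge_ge: "h \<le> ?m {t\<in>e. s \<le> f t}"
  proof (cases "s = 0")
    case True
    then show ?thesis using h nonneg by simp
  next
    case False
    \<comment> \<open>The decrement is a fraction of \<open>s\<close>, so that the level stays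
      nonnegative; lying below the infimum of \<open>Q\<close>, it can only fail the measure
      condition.\<close>
    have below: "h \<le> ?m {t\<in>e. s - s / real (Suc n) < f t}" for n
    proof (rule ccontr)
      assume "\<not> ?thesis"
      moreover have "s / real (Suc n) \<le> s" using s0 by (simp add: divide_le_eq mult_le_cancel_left1)
      ultimately have "s - s / real (Suc n) \<in> Q"
        by (auto simp: Q_def)
      then have "s \<le> s - s / real (Suc n)" unfolding s_def
        using Q_bdd by (metis cInf_lower s_def)
      then show False using False s0 by (auto simp: zero_le_divide_iff field_simps)
    qed
    have "decseq (\<lambda>n. {t\<in>e. s - s / real (Suc n) < f t})"
      unfolding decseq_def by (intro allI impI gt_mono diff_left_mono divide_left_mono s0) auto
    then have "(\<lambda>n. ?m {t\<in>e. s - s / real (Suc n) < f t}) \<longlonglongrightarrow> ?m (\<Inter>n. {t\<in>e. s - s / real (Suc n) < f t})"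
      by (intro unit_leb.finite_Lim_measure_decseq) (auto intro: gt_sets)
    moreover have "(\<Inter>n. {t\<in>e. s - s / real (Suc n) < f t}) = {t\<in>e. s \<le> f t}"
    proof (intro equalityI subsetI)
      fix t assume t: "t \<in> (\<Inter>n. {t\<in>e. s - s / real (Suc n) < f t})"
      have "(\<lambda>n. s - s * inverse (real (Suc n))) \<longlonglongrightarrow> s - s * 0"
        by (intro tendsto_intros LIMSEQ_inverse_real_of_nat)
      then have "s \<le> f t"
        using t by (intro LIMSEQ_le_const2[of _ s])
          (auto simp: field_simps intro!: exI[of _ 0] less_imp_le)
      then show "t \<in> {t\<in>e. s \<le> f t}" using t by auto
    next
      fix t assume t: "t \<in> {t\<in>e. s \<le> f t}"
      have "s - s / real (Suc n) < f t" for n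
      proof -
        have "0 < s / real (Suc n)" using s0 False by simp
        moreover have "s \<le> f t" using t by simp
        ultimately show ?thesis by linarith
      qed
      then show "t \<in> (\<Inter>n. {t\<in>e. s - s / real (Suc n) < f t})"
        using t by blast
    qed
    ultimately show ?thesis
      using below by (metis (no_types, lifting) LIMSEQ_le_const)
  qed
  let ?G = "{t\<in>e. s < f t}" and ?H = "{t\<in>e. s \<le> f t}"
  have "?m (?H - ?G) = ?m ?H - ?m ?G"
    using gt_sets ge_sets by (intro unit_leb.finite_measure_Diff) auto
  then have "0 \<le> h - ?m ?G" "h - ?m ?G \<le> ?m (?H - ?G)" using gt_le ge_ge by linarith+
  \<comment> \<open>On the plateau \<open>?H - ?G\<close> the function equals \<open>s\<close>, so
    any part of it of the missing measure will do.\<close>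
  then obtain C where C: "C \<in> sets unit_leb" "C \<subseteq> ?H - ?G" "?m C = h - ?m ?G"
    by (rule unit_leb_subset_of_measure[OF sets.Diff[OF ge_sets gt_sets]])
  show thesis
  proof (rule that[of s "?G \<union> C"])
    show "?m (?G \<union> C) = h"
      using C gt_sets by (subst unit_leb.finite_measure_Union) auto
    show "?G \<union> C \<in> sets unit_leb" using C gt_sets by auto
    show "s \<le> f t" if "t \<in> ?G \<union> C" for t using that C(2) by auto
    show "f t \<le> s" if "t \<in> e - (?G \<union> C)" for t using that by (auto simp: not_less)
    show "?G \<union> C \<subseteq> e" using C(2) by auto
  qed (fact s0)
qed

text \<open>Cut \<open>e\<close> into pieces of measure \<open>d\<close> along descending thresholds \<open>s i\<close>. On each piece but the first,
  \<open>f\<close> is at most the threshold of the piece before it, so only the first piece costs \<open>d * M\<close>.\<close>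

lemma step_function_below_threshold:
  fixes f :: "real \<Rightarrow> real"
  assumes f: "integrable unit_leb f" and nonneg: "\<And>t. 0 \<le> f t" and d: "0 < d"
    and e: "e \<in> sets unit_leb" "measure unit_leb e = real n * d" "\<And>t. t \<in> e \<Longrightarrow> f t \<le> M"
  shows "\<exists>A s. (\<forall>i<n. A i \<in> sets unit_leb \<and> A i \<subseteq> e \<and> measure unit_leb (A i) = d \<and> 0 \<le> s i \<and>
            (\<forall>t\<in>A i. s i \<le> f t)) \<and> disjoint_family_on A {..<n} \<and>
          (LINT t|unit_leb. f t * indicator e t) \<le> d * max 0 M + d * (\<Sum>i<n. s i)"
  using e
proof (induction n arbitrary: e M)
  case 0
  then have "AE t in unit_leb. t \<notin> e"
    by (intro AE_not_in) (simp add: null_sets_def unit_leb.emeasure_eq_measure)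
  then have "AE t in unit_leb. f t * indicator e t = 0" by eventually_elim simp
  then have "(LINT t|unit_leb. f t * indicator e t) = 0" by (rule integral_eq_zero_AE)
  \<comment> \<open>For empty \<open>e\<close> the bound \<open>M\<close> may be negative;
    \<open>max 0 M\<close> keeps the right-hand side nonnegative.\<close>
  then show ?case using d by (auto simp: disjoint_family_on_def)
next
  case (Suc n)
  have [measurable]: "f \<in> borel_measurable unit_leb" using f by auto
  have "d \<le> measure unit_leb e" using Suc.prems d by (simp add: algebra_simps)
  then obtain s0 e' where e': "0 \<le> s0" "e' \<in> sets unit_leb" "e' \<subseteq> e" "measure unit_leb e' = d"
    "\<And>t. t \<in> e' \<Longrightarrow> s0 \<le> f t" "\<And>t. t \<in> e - e' \<Longrightarrow> f t \<le> s0"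
    using unit_leb_threshold_set[of f e d] nonneg d Suc.prems(1) by auto
  have int: "integrable unit_leb (\<lambda>t. f t * indicator a t)" if "a \<in> sets unit_leb" for a
    using that f by (rule integrable_real_mult_indicator)
  have "measure unit_leb (e - e') = real n * d"
    using e' Suc.prems by (subst unit_leb.finite_measure_Diff) (auto simp: algebra_simps)
  from Suc.IH[OF sets.Diff[OF Suc.prems(1) e'(2)] this, OF e'(6)] obtain A s where As:
    "\<forall>i<n. A i \<in> sets unit_leb \<and> A i \<subseteq> e - e' \<and> measure unit_leb (A i) = d \<and> 0 \<le> s i \<and>
            (\<forall>t\<in>A i. s i \<le> f t)" "disjoint_family_on A {..<n}"
    "(LINT t|unit_leb. f t * indicator (e - e') t) \<le> d * max 0 s0 + d * (\<Sum>i<n. s i)"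
    by blast
  have "(LINT t|unit_leb. f t * indicator e t) =
      (LINT t|unit_leb. f t * indicator e' t + f t * indicator (e - e') t)"
    using e'(3) by (intro Bochner_Integration.integral_cong) (auto split: split_indicator)
  also have "\<dots> = (LINT t|unit_leb. f t * indicator e' t) + (LINT t|unit_leb. f t * indicator (e - e') t)"
    using e' Suc.prems by (intro Bochner_Integration.integral_add int) auto
  also have "(LINT t|unit_leb. f t * indicator e' t) \<le> (LINT t|unit_leb. max 0 M * indicator e' t)"
    using e' Suc.prems
    by (intro integral_mono int integrable_mult_right integrable_real_indicator)
      (auto split: split_indicator simp: unit_leb.emeasure_eq_measure le_max_iff_disj)
  also have "\<dots> = d * max 0 M"
    using e' by (simp add: Int_absorb2 sets_unit_leb_subset)
  \<comment> \<open>The rest was treated with \<open>s0\<close> as its upper bound. Since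
    \<open>s0\<close> is nonnegative, the cost \<open>d * max 0 s0\<close> of its first piece is the
    new summand of the sum.\<close>
  finally have le: "(LINT t|unit_leb. f t * indicator e t) \<le> d * max 0 M + d * (s0 + (\<Sum>i<n. s i))"
    using As(3) e'(1) by (simp add: algebra_simps)
  show ?case
  proof (intro exI conjI)
    show "\<forall>i<Suc n. case_nat e' A i \<in> sets unit_leb \<and> case_nat e' A i \<subseteq> e \<and>
        measure unit_leb (case_nat e' A i) = d \<and> 0 \<le> case_nat s0 s i \<and>
        (\<forall>t\<in>case_nat e' A i. case_nat s0 s i \<le> f t)"
      using As(1) e' by (auto split: nat.split)
    show "disjoint_family_on (case_nat e' A) {..<Suc n}"
      unfolding disjoint_family_on_def
    proof (intro ballI impI)
      fix i j :: nat assume "i \<in> {..<Suc n}" "j \<in> {..<Suc n}" "i \<noteq> j"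
      then show "case_nat e' A i \<inter> case_nat e' A j = {}"
        using As(1,2) by (cases i; cases j) (simp_all add: disjoint_family_on_def; blast)+
    qed
    show "(LINT t|unit_leb. f t * indicator e t) \<le> d * max 0 M + d * (\<Sum>i<Suc n. case_nat s0 s i)"
      using le by (simp add: sum.lessThan_Suc_shift del: sum.lessThan_Suc)
  qed
qed

subsection \<open>Averaging in symmetric spaces\<close>

lemma sum_indicator_disjoint:
  fixes a :: "'i \<Rightarrow> real"
  assumes "finite I" "disjoint_family_on A I" "i \<in> I" "t \<in> A i"
  shows "(\<Sum>j\<in>I. a j * indicator (A j) t) = a i"
proof -
  have "(\<Sum>j\<in>I. a j * indicator (A j) t) = (\<Sum>j\<in>I. if j = i then a i else 0)"
    using assms(2-4) by (intro sum.cong) (auto simp: disjoint_family_on_def split: split_indicator)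
  then show ?thesis using assms by simp
qed

text \<open>At a level \<open>c \<ge> 0\<close> the superlevel set is the disjoint union of the
  pieces whose value exceeds \<open>c\<close> in modulus. Its measure is \<open>d\<close> times
  their number, which a permutation of the values preserves.\<close>

lemma abs_equimeasurable_permuted_steps:
  fixes a :: "'i \<Rightarrow> real"
  assumes I: "finite I" and disj: "disjoint_family_on A I" and p: "bij_betw p I I"
    and A: "\<And>i. i \<in> I \<Longrightarrow> A i \<in> sets unit_leb" "\<And>i. i \<in> I \<Longrightarrow> measure unit_leb (A i) = d"
  shows "abs_equimeasurable (\<lambda>t. \<Sum>i\<in>I. a (p i) * indicator (A i) t) (\<lambda>t. \<Sum>i\<in>I. a i * indicator (A i) t)"
proof -
  have level: "measure unit_leb {t\<in>{0..1}. c < \<bar>\<Sum>i\<in>I. b i * indicator (A i) t\<bar>} =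
      real (card {i\<in>I. c < \<bar>b i\<bar>}) * d" if c: "0 \<le> c" for b :: "'i \<Rightarrow> real" and c
  proof -
    have "{t\<in>{0..1}. c < \<bar>\<Sum>i\<in>I. b i * indicator (A i) t\<bar>} = (\<Union>i\<in>{i\<in>I. c < \<bar>b i\<bar>}. A i)"
    proof (intro equalityI subsetI)
      fix t assume t: "t \<in> {t\<in>{0..1}. c < \<bar>\<Sum>i\<in>I. b i * indicator (A i) t\<bar>}"
      then have "\<exists>i\<in>I. t \<in> A i"
        using c by (cases "\<exists>i\<in>I. t \<in> A i") (auto simp: sum.neutral)
      then obtain i where "i \<in> I" "t \<in> A i" by auto
      then show "t \<in> (\<Union>i\<in>{i\<in>I. c < \<bar>b i\<bar>}. A i)"
        using t sum_indicator_disjoint[OF I disj, of i t b] by auto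
    next
      fix t assume "t \<in> (\<Union>i\<in>{i\<in>I. c < \<bar>b i\<bar>}. A i)"
      then obtain i where "i \<in> I" "t \<in> A i" "c < \<bar>b i\<bar>" by auto
      then show "t \<in> {t\<in>{0..1}. c < \<bar>\<Sum>i\<in>I. b i * indicator (A i) t\<bar>}"
        using sum_indicator_disjoint[OF I disj, of i t b] sets_unit_leb_subset[OF A(1)[of i]] by auto
    qed
    also have "measure unit_leb \<dots> = (\<Sum>i\<in>{i\<in>I. c < \<bar>b i\<bar>}. measure unit_leb (A i))"
      using I A disj by (intro unit_leb.finite_measure_finite_Union) (auto simp: disjoint_family_on_def)
    also have "\<dots> = real (card {i\<in>I. c < \<bar>b i\<bar>}) * d" using A by simp
    finally show ?thesis .
  qed
  have "card {i\<in>I. c < \<bar>a (p i)\<bar>} = card {i\<in>I. c < \<bar>a i\<bar>}" for c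
  proof (rule bij_betw_same_card)
    show "bij_betw p {i\<in>I. c < \<bar>a (p i)\<bar>} {i\<in>I. c < \<bar>a i\<bar>}"
      using p by (auto simp: bij_betw_def inj_on_def image_iff)
  qed
  then have "measure unit_leb {t\<in>{0..1}. c < \<bar>\<Sum>i\<in>I. a (p i) * indicator (A i) t\<bar>} =
      measure unit_leb {t\<in>{0..1}. c < \<bar>\<Sum>i\<in>I. a i * indicator (A i) t\<bar>}" for c
  proof (cases "0 \<le> c")
    case False
    then have "c < \<bar>r\<bar>" for r using abs_ge_zero[of r] by linarith
    then show ?thesis by simp
  qed (simp only: level)
  then show ?thesis by (simp add: abs_equimeasurable_def)
qed

lemma abs_equimeasurable_indicator:
  assumes "a \<in> sets unit_leb" "b \<in> sets unit_leb" "measure unit_leb a = measure unit_leb b"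
  shows "abs_equimeasurable (indicator a) (indicator b)"
proof -
  have "{t\<in>{0..1}. s < \<bar>indicator c t :: real\<bar>} = (if s < 0 then {0..1} else if s < 1 then c else {})"
    if "c \<in> sets unit_leb" for c s
    using sets_unit_leb_subset[OF that] by (auto split: split_indicator if_splits)
  with assms show ?thesis by (simp add: abs_equimeasurable_def)
qed

section \<open>Norms and indicators in a symmetric space\<close>

context
  fixes E N assumes sym: "symmetric_space (E, N)"
begin

lemmas symmetric_space_unfolded =
  sym[unfolded symmetric_space_def banach_function_space_def linear_function_space_def prod.case]

lemma symmetric_space_nonneg: "x \<in> E \<Longrightarrow> 0 \<le> N x"
  using symmetric_space_unfolded by blast

lemma symmetric_space_norm_zero_iff: "x \<in> E \<Longrightarrow> N x = 0 \<longleftrightarrow> (AE t in unit_leb. x t = 0)"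
  using symmetric_space_unfolded by blast

lemma symmetric_space_scale: "x \<in> E \<Longrightarrow> (\<lambda>t. a * x t) \<in> E" "x \<in> E \<Longrightarrow> N (\<lambda>t. a * x t) = \<bar>a\<bar> * N x"
  using symmetric_space_unfolded by blast+

lemma symmetric_space_add:
  assumes "x \<in> E" "y \<in> E"
  shows "(\<lambda>t. x t + y t) \<in> E" "N (\<lambda>t. x t + y t) \<le> N x + N y"
  using symmetric_space_unfolded assms by blast+

lemma symmetric_space_ideal:
  assumes "x \<in> E" "y \<in> borel_measurable unit_leb" "AE t in unit_leb. \<bar>y t\<bar> \<le> \<bar>x t\<bar>"
  shows "y \<in> E" "N y \<le> N x"
  using symmetric_space_unfolded assms by blast+

lemma symmetric_space_rearrange:
  assumes "x \<in> E" "y \<in> borel_measurable unit_leb" "abs_equimeasurable y x"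
  shows "y \<in> E" "N y = N x"
  using symmetric_space_unfolded assms by blast+

lemma symmetric_space_unit: "indicator {0..1} \<in> E"
  using symmetric_space_unfolded by blast

lemma symmetric_space_sum:
  assumes "finite K" "\<And>k. k \<in> K \<Longrightarrow> x k \<in> E"
  shows "(\<lambda>t. \<Sum>k\<in>K. x k t) \<in> E \<and> N (\<lambda>t. \<Sum>k\<in>K. x k t) \<le> (\<Sum>k\<in>K. N (x k))"
  using assms
proof (induction K rule: finite_induct)
  case empty
  have b: "(\<lambda>t. 0) \<in> E" using symmetric_space_unfolded by blast
  then show ?case using symmetric_space_norm_zero_iff[OF b] by simp
next
  case (insert k K)
  have IH: "(\<lambda>t. \<Sum>k\<in>K. x k t) \<in> E" "N (\<lambda>t. \<Sum>k\<in>K. x k t) \<le> (\<Sum>k\<in>K. N (x k))"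
    using insert by auto
  then show ?case using symmetric_space_add[of "x k" "\<lambda>t. \<Sum>k\<in>K. x k t"] insert.hyps insert.prems[of k]
    by simp
qed

lemma symmetric_space_indicator:
  assumes "e \<in> sets unit_leb"
  shows "indicator e \<in> E"
proof (rule symmetric_space_ideal)
  show "indicator {0..1} \<in> E" by (rule symmetric_space_unit)
  show "AE t in unit_leb. \<bar>indicator e t\<bar> \<le> \<bar>indicator {0..1} t :: real\<bar>"
    using sets_unit_leb_subset[OF assms] by (intro AE_I2) (auto split: split_indicator)
qed (use assms in auto)

lemma symmetric_space_norm_indicator:
  assumes e: "e \<in> sets unit_leb" and \<tau>: "measure unit_leb e = \<tau>" "0 \<le> \<tau>" "\<tau> \<le> 1"
  shows "N (indicator e) = fundamental_function (E, N) \<tau>"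
proof -
  have "abs_equimeasurable (indicator e) (indicator {0..\<tau>})"
    using assms by (intro abs_equimeasurable_indicator interval_in_sets_unit_leb)
      (auto simp: measure_unit_leb_interval)
  then show ?thesis
    using symmetric_space_rearrange(2)[OF symmetric_space_indicator[of "{0..\<tau>}"], of "indicator e"] assms
    by (simp add: fundamental_function_def interval_in_sets_unit_leb)
qed

text \<open>Averaging over the cyclic permutations of the pieces turns the step function into a
  multiple of the indicator of its support.\<close>

lemma symmetric_space_cyclic_average:
  fixes A :: "nat \<Rightarrow> real set" and s :: "nat \<Rightarrow> real"
  assumes A: "\<And>i. i < n \<Longrightarrow> A i \<in> sets unit_leb" "\<And>i. i < n \<Longrightarrow> measure unit_leb (A i) = d"
    and disj: "disjoint_family_on A {..<n}" and s: "\<And>i. i < n \<Longrightarrow> 0 \<le> s i"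
    and E: "(\<lambda>t. \<Sum>i<n. s i * indicator (A i) t) \<in> E"
  shows "(\<Sum>i<n. s i) * N (indicator (\<Union>i<n. A i)) \<le> real n * N (\<lambda>t. \<Sum>i<n. s i * indicator (A i) t)"
proof -
  \<comment> \<open>For indices below \<open>n\<close> this is addition modulo \<open>n\<close>;
    \<open>z k\<close> is the step function with its values shifted cyclically by
    \<open>k\<close>.\<close>
  define p :: "nat \<Rightarrow> nat \<Rightarrow> nat" where "p k i = (if i + k < n then i + k else i + k - n)" for k i
  define z where "z k t = (\<Sum>i<n. s (p k i) * indicator (A i) t)" for k t
  have p: "bij_betw (p k) {..<n} {..<n}" if "k < n" for k
    using that by (intro bij_betw_byWitness[where f' = "\<lambda>j. if k \<le> j then j - k else j + n - k"])
      (auto simp: p_def split: if_splits)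
  \<comment> \<open>By symmetry, on a fixed piece \<open>i\<close> the shifts \<open>k\<close> run
    through all values of \<open>s\<close>, so every piece receives the same total.\<close>
  have p_sym: "p k i = p i k" for k i by (simp add: p_def add.commute)
  have meas: "z k \<in> borel_measurable unit_leb" for k
    unfolding z_def using A by (intro borel_measurable_sum borel_measurable_times) auto
  have zE: "z k \<in> E \<and> N (z k) = N (\<lambda>t. \<Sum>i<n. s i * indicator (A i) t)" if "k < n" for k
  proof -
    have "abs_equimeasurable (z k) (\<lambda>t. \<Sum>i<n. s i * indicator (A i) t)"
      unfolding z_def using A disj p[OF that] by (intro abs_equimeasurable_permuted_steps) auto
    then show ?thesis using symmetric_space_rearrange[OF E meas] by auto
  qed
  have "(\<Sum>k<n. z k t) = (\<Sum>i<n. s i) * indicator (\<Union>i<n. A i) t" for t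
  proof -
    have "(\<Sum>k<n. z k t) = (\<Sum>i<n. (\<Sum>k<n. s (p i k)) * indicator (A i) t)"
      unfolding z_def by (subst sum.swap) (simp add: sum_distrib_right p_sym)
    also have "\<dots> = (\<Sum>i<n. (\<Sum>k<n. s k) * indicator (A i) t)"
      using p by (intro sum.cong refl arg_cong2[where f = "(*)"] sum.reindex_bij_betw) auto
    also have "\<dots> = (\<Sum>i<n. s i) * indicator (\<Union>i<n. A i) t"
    proof (cases "\<exists>i<n. t \<in> A i")
      case True
      then obtain i where i: "i < n" "t \<in> A i" by auto
      then have "(\<Sum>i<n. (\<Sum>k<n. s k) * indicator (A i) t) = (\<Sum>k<n. s k)"
        using sum_indicator_disjoint[OF _ disj, of i t "\<lambda>_. \<Sum>k<n. s k"] by simp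
      moreover have "t \<in> (\<Union>i<n. A i)" using i by auto
      ultimately show ?thesis by simp
    qed auto
    finally show ?thesis .
  qed
  then have eq: "(\<lambda>t. \<Sum>k<n. z k t) = (\<lambda>t. (\<Sum>i<n. s i) * indicator (\<Union>i<n. A i) t)" by auto
  have "N (\<lambda>t. \<Sum>k<n. z k t) \<le> (\<Sum>k<n. N (z k))"
    using zE by (intro symmetric_space_sum[THEN conjunct2]) auto
  also have "\<dots> = real n * N (\<lambda>t. \<Sum>i<n. s i * indicator (A i) t)" using zE by simp
  finally have "\<bar>\<Sum>i<n. s i\<bar> * N (indicator (\<Union>i<n. A i)) \<le>
      real n * N (\<lambda>t. \<Sum>i<n. s i * indicator (A i) t)"
    using A unfolding eq by (subst (asm) symmetric_space_scale) (auto intro!: symmetric_space_indicator)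
  moreover have "0 \<le> (\<Sum>i<n. s i)" using s by (intro sum_nonneg) auto
  ultimately show ?thesis by simp
qed

text \<open>Two limits are taken: for \<open>\<bar>x\<bar>\<close> truncated at \<open>M\<close>,
  cutting \<open>e\<close> into \<open>n\<close> pieces gives the inequality up to an error of order
  \<open>M / n\<close>; then \<open>n\<close> and afterwards \<open>M\<close> tend to
  infinity.\<close>

lemma fundamental_function_times_L1_norm_le:
  assumes x: "x \<in> E" "x \<in> L1_space"
    and e: "e \<in> sets unit_leb" "measure unit_leb e = \<tau>" and \<tau>: "0 < \<tau>" "\<tau> \<le> 1"
  shows "fundamental_function (E, N) \<tau> * L1_norm (\<lambda>t. x t * indicator e t) \<le> \<tau> * N x"
proof -
  let ?\<phi> = "fundamental_function (E, N) \<tau>"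
  have xint: "integrable unit_leb x" using x by (simp add: L1_space_def)
  then have [measurable]: "x \<in> borel_measurable unit_leb" by auto
  note [measurable] = e(1)
  have phi: "N (indicator a) = ?\<phi>" if "a \<in> sets unit_leb" "measure unit_leb a = \<tau>" for a
    using that \<tau> by (intro symmetric_space_norm_indicator) auto
  have phi0: "0 \<le> ?\<phi>" using phi[OF e] symmetric_space_nonneg symmetric_space_indicator e by metis
  have bounded: "?\<phi> * (LINT t|unit_leb. min \<bar>x t\<bar> (real M) * indicator e t) \<le> \<tau> * N x" for M
  proof -
    define f where "f t = min \<bar>x t\<bar> (real M)" for t
    have fm [measurable]: "f \<in> borel_measurable unit_leb" unfolding f_def by measurable
    have fint: "integrable unit_leb f"
      by (rule Bochner_Integration.integrable_bound[OF xint]) (auto simp: f_def)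
    \<comment> \<open>The last term is the cost \<open>d * M\<close> of the piece with the largest
      values, where \<open>d = \<tau> / n\<close> and \<open>n = Suc m\<close>.\<close>
    have "?\<phi> * (LINT t|unit_leb. f t * indicator e t) \<le> \<tau> * N x + ?\<phi> * \<tau> * M * inverse (real (Suc m))" for m
    proof -
      define n where "n = Suc m"
      define d where "d = \<tau> / real n"
      have n0: "0 < real n" by (simp add: n_def)
      have "\<exists>A s. (\<forall>i<n. A i \<in> sets unit_leb \<and> A i \<subseteq> e \<and> measure unit_leb (A i) = d \<and> 0 \<le> s i \<and>
            (\<forall>t\<in>A i. s i \<le> f t)) \<and> disjoint_family_on A {..<n} \<and>
          (LINT t|unit_leb. f t * indicator e t) \<le> d * max 0 (real M) + d * (\<Sum>i<n. s i)"
      proof (rule step_function_below_threshold[OF fint _ _ e(1)])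
        show "f t \<le> real M" for t by (simp add: f_def)
        show "0 \<le> f t" for t by (simp add: f_def)
      qed (use n0 \<tau> e in \<open>auto simp: d_def\<close>)
      then obtain A s where As: "\<And>i. i < n \<Longrightarrow> A i \<in> sets unit_leb"
          "\<And>i. i < n \<Longrightarrow> measure unit_leb (A i) = d" "\<And>i. i < n \<Longrightarrow> 0 \<le> s i"
          "\<And>i t. i < n \<Longrightarrow> t \<in> A i \<Longrightarrow> s i \<le> f t" and disj: "disjoint_family_on A {..<n}"
        and le: "(LINT t|unit_leb. f t * indicator e t) \<le> d * max 0 (real M) + d * (\<Sum>i<n. s i)"
        by blast
      let ?z = "\<lambda>t. \<Sum>i<n. s i * indicator (A i) t"
      have "\<bar>?z t\<bar> \<le> \<bar>x t\<bar>" for t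
      proof (cases "\<exists>i<n. t \<in> A i")
        case True
        then obtain i where i: "i < n" "t \<in> A i" by auto
        then show ?thesis
          using sum_indicator_disjoint[OF _ disj, of i t s] As(3)[of i] As(4)[of i t] by (auto simp: f_def)
      qed (auto simp: sum.neutral)
      moreover have "?z \<in> borel_measurable unit_leb"
        using As by (intro borel_measurable_sum borel_measurable_times) auto
      ultimately have z: "?z \<in> E" "N ?z \<le> N x" using symmetric_space_ideal[OF x(1)] by auto
      \<comment> \<open>The pieces together have measure \<open>\<tau>\<close>, so the norm of the
        indicator of their union is the value of the fundamental function.\<close>
      have "measure unit_leb (\<Union>i<n. A i) = (\<Sum>i<n. measure unit_leb (A i))"
        using As disj by (intro unit_leb.finite_measure_finite_Union) auto
      then have "measure unit_leb (\<Union>i<n. A i) = \<tau>" using As n0 by (simp add: d_def)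
      then have "N (indicator (\<Union>i<n. A i)) = ?\<phi>" using As(1) by (intro phi sets.finite_UN) auto
      moreover have "(\<Sum>i<n. s i) * N (indicator (\<Union>i<n. A i)) \<le> real n * N ?z"
        using As disj z(1) by (intro symmetric_space_cyclic_average) auto
      ultimately have "(\<Sum>i<n. s i) * ?\<phi> \<le> real n * N ?z" by simp
      also have "\<dots> \<le> real n * N x" using z n0 by auto
      finally have avg: "(\<Sum>i<n. s i) * ?\<phi> * d \<le> \<tau> * N x"
        using n0 \<tau> by (simp add: d_def field_simps)
      have "?\<phi> * (LINT t|unit_leb. f t * indicator e t) \<le> ?\<phi> * (d * max 0 (real M) + d * (\<Sum>i<n. s i))"
        using le phi0 by (rule mult_left_mono)
      also have "\<dots> = ?\<phi> * \<tau> * M * inverse (real n) + (\<Sum>i<n. s i) * ?\<phi> * d"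
        by (simp add: d_def field_simps)
      also have "\<dots> \<le> ?\<phi> * \<tau> * M * inverse (real n) + \<tau> * N x" using avg by simp
      finally show ?thesis by (simp add: n_def)
    qed
    moreover have "(\<lambda>m. \<tau> * N x + ?\<phi> * \<tau> * M * inverse (real (Suc m))) \<longlonglongrightarrow> \<tau> * N x + ?\<phi> * \<tau> * M * 0"
      by (intro tendsto_intros LIMSEQ_inverse_real_of_nat)
    ultimately show ?thesis
      by (intro LIMSEQ_le_const[of _ "\<tau> * N x"]) (auto simp: f_def)
  qed
  have "(\<lambda>M. LINT t|unit_leb. min \<bar>x t\<bar> (real M) * indicator e t) \<longlonglongrightarrow> (LINT t|unit_leb. \<bar>x t\<bar> * indicator e t)"
  proof (rule integral_dominated_convergence[where w = "\<lambda>t. \<bar>x t\<bar>"])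
    have "(\<lambda>M. min \<bar>x t\<bar> (real M) * indicator e t) \<longlonglongrightarrow> \<bar>x t\<bar> * indicator e t" for t
    proof (rule tendsto_eventually)
      obtain M0 where "\<bar>x t\<bar> < real M0" using reals_Archimedean2 by blast
      then show "\<forall>\<^sub>F M in sequentially. min \<bar>x t\<bar> (real M) * indicator e t = \<bar>x t\<bar> * indicator e t"
        by (intro eventually_sequentiallyI[of M0]) auto
    qed
    then show "AE t in unit_leb. (\<lambda>M. min \<bar>x t\<bar> (real M) * indicator e t) \<longlonglongrightarrow> \<bar>x t\<bar> * indicator e t"
      by simp
  qed (use xint in \<open>auto split: split_indicator\<close>)
  then have "(\<lambda>M. ?\<phi> * (LINT t|unit_leb. min \<bar>x t\<bar> (real M) * indicator e t)) \<longlonglongrightarrow>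
      ?\<phi> * (LINT t|unit_leb. \<bar>x t\<bar> * indicator e t)"
    by (intro tendsto_intros)
  then have "?\<phi> * (LINT t|unit_leb. \<bar>x t\<bar> * indicator e t) \<le> \<tau> * N x"
    using bounded by (intro LIMSEQ_le_const2) auto
  then show ?thesis by (simp add: L1_norm_def abs_mult)
qed

end

subsection \<open>Integrals over sets and rearrangement\<close>

lemma L1_space_measurable: "x \<in> L1_space \<Longrightarrow> x \<in> borel_measurable unit_leb"
  by (auto simp: L1_space_def)

lemma L1_space_add: "x \<in> L1_space \<Longrightarrow> y \<in> L1_space \<Longrightarrow> (\<lambda>t. x t + y t) \<in> L1_space"
  by (simp add: L1_space_def)

lemma L1_space_diff: "x \<in> L1_space \<Longrightarrow> y \<in> L1_space \<Longrightarrow> (\<lambda>t. x t - y t) \<in> L1_space"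
  by (simp add: L1_space_def)

lemma L1_space_scale: "x \<in> L1_space \<Longrightarrow> (\<lambda>t. a * x t) \<in> L1_space"
  by (simp add: L1_space_def)

lemma L1_space_indicator: "x \<in> L1_space \<Longrightarrow> e \<in> sets unit_leb \<Longrightarrow> (\<lambda>t. x t * indicator e t) \<in> L1_space"
  by (simp add: L1_space_def integrable_real_mult_indicator)

lemma L1_norm_nonneg: "0 \<le> L1_norm x"
  by (simp add: L1_norm_def)

lemma L1_norm_scale: "L1_norm (\<lambda>t. a * x t) = \<bar>a\<bar> * L1_norm x"
  by (simp add: L1_norm_def abs_mult)

lemma L1_norm_triangle: "x \<in> L1_space \<Longrightarrow> y \<in> L1_space \<Longrightarrow> L1_norm (\<lambda>t. x t + y t) \<le> L1_norm x + L1_norm y"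
  unfolding L1_norm_def L1_space_def
  using Bochner_Integration.integral_add[of unit_leb "\<lambda>t. \<bar>x t\<bar>" "\<lambda>t. \<bar>y t\<bar>"]
    integral_mono[of unit_leb "\<lambda>t. \<bar>x t + y t\<bar>" "\<lambda>t. \<bar>x t\<bar> + \<bar>y t\<bar>"] by auto

lemma L1_norm_eq_0_iff: "x \<in> L1_space \<Longrightarrow> L1_norm x = 0 \<longleftrightarrow> (AE t in unit_leb. x t = 0)"
  unfolding L1_norm_def L1_space_def by (subst integral_nonneg_eq_0_iff_AE) auto

lemma L1_norm_mono_AE:
  assumes "x \<in> L1_space" "y \<in> borel_measurable unit_leb" "AE t in unit_leb. \<bar>y t\<bar> \<le> \<bar>x t\<bar>"
  shows "y \<in> L1_space" "L1_norm y \<le> L1_norm x"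
proof -
  show y: "y \<in> L1_space"
    using Bochner_Integration.integrable_bound[of unit_leb x y] assms
    unfolding L1_space_def real_norm_def by blast
  have "integrable unit_leb (\<lambda>t. \<bar>y t\<bar>)" "integrable unit_leb (\<lambda>t. \<bar>x t\<bar>)"
    using assms(1) y by (simp_all add: L1_space_def)
  then show "L1_norm y \<le> L1_norm x"
    unfolding L1_norm_def using assms(3) by (rule integral_mono_AE)
qed

lemma L1_norm_indicator_mono:
  assumes "x \<in> L1_space" "a \<in> sets unit_leb" "b \<in> sets unit_leb" "a \<subseteq> b"
  shows "L1_norm (\<lambda>t. x t * indicator a t) \<le> L1_norm (\<lambda>t. x t * indicator b t)"
  using assms
  by (intro L1_norm_mono_AE(2) L1_space_indicator L1_space_measurable AE_I2) (auto split: split_indicator)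

lemma L1_norm_indicator_unit: "L1_norm (\<lambda>t. x t * indicator {0..1} t) = L1_norm x"
  unfolding L1_norm_def by (intro Bochner_Integration.integral_cong) auto

lemma L1_norm_indicator_le:
  assumes "x \<in> L1_space" "e \<in> sets unit_leb"
  shows "L1_norm (\<lambda>t. x t * indicator e t) \<le> L1_norm x"
  using L1_norm_indicator_mono[OF assms(1,2), of "{0..1}"] assms(2)
  by (simp add: L1_norm_indicator_unit interval_in_sets_unit_leb sets_unit_leb_subset)

text \<open>With \<open>e'\<close> carrying the largest values of \<open>\<bar>x\<bar>\<close> on
  \<open>e\<close>, the threshold \<open>s\<close> separates the mean over \<open>e'\<close> from
  the mean over \<open>e - e'\<close>. So the mean over \<open>e'\<close> is at least that over
  \<open>e\<close>, stated here without division.\<close>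

lemma L1_norm_indicator_concentrate:
  assumes x: "x \<in> L1_space" and e: "e \<in> sets unit_leb" and h: "0 < h" "h \<le> measure unit_leb e"
  obtains e' where "e' \<in> sets unit_leb" "measure unit_leb e' = h"
    "h * L1_norm (\<lambda>t. x t * indicator e t) \<le> measure unit_leb e * L1_norm (\<lambda>t. x t * indicator e' t)"
proof -
  let ?L = "\<lambda>a. L1_norm (\<lambda>t. x t * indicator a t)"
  have [measurable]: "x \<in> borel_measurable unit_leb" using x by (rule L1_space_measurable)
  obtain s e' where s: "0 \<le> s" "e' \<in> sets unit_leb" "e' \<subseteq> e" "measure unit_leb e' = h"
    "\<And>t. t \<in> e' \<Longrightarrow> s \<le> \<bar>x t\<bar>" "\<And>t. t \<in> e - e' \<Longrightarrow> \<bar>x t\<bar> \<le> s"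
    using unit_leb_threshold_set[of "\<lambda>t. \<bar>x t\<bar>" e h] e h by auto
  have int: "integrable unit_leb (\<lambda>t. \<bar>x t\<bar> * indicator a t)" if "a \<in> sets unit_leb" for a
    using that x by (intro integrable_real_mult_indicator) (auto simp: L1_space_def)
  have cint: "integrable unit_leb (\<lambda>t. s * indicator a t)" if "a \<in> sets unit_leb" for a
    using that by (intro integrable_mult_right integrable_real_indicator) (auto simp: unit_leb.emeasure_eq_measure)
  have L: "?L a = (LINT t|unit_leb. \<bar>x t\<bar> * indicator a t)" for a
    by (simp add: L1_norm_def abs_mult)
  have const: "(LINT t|unit_leb. s * indicator a t) = s * measure unit_leb a" if "a \<in> sets unit_leb" for a
    using sets_unit_leb_subset[OF that] by (simp add: Int_absorb2)
  have d: "e - e' \<in> sets unit_leb" using e s by auto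
  have "?L e = (LINT t|unit_leb. \<bar>x t\<bar> * indicator e' t + \<bar>x t\<bar> * indicator (e - e') t)"
    unfolding L using s(3) by (intro Bochner_Integration.integral_cong) (auto split: split_indicator)
  also have "\<dots> = ?L e' + ?L (e - e')"
    unfolding L using s(2) d by (intro Bochner_Integration.integral_add int)
  finally have split: "?L e = ?L e' + ?L (e - e')" .
  have "s * h \<le> ?L e'"
    unfolding L s(4)[symmetric] const[OF s(2), symmetric] using s
    by (intro integral_mono int cint) (auto split: split_indicator)
  moreover have "?L (e - e') \<le> s * measure unit_leb (e - e')"
    unfolding L const[OF d, symmetric] using s d
    by (intro integral_mono int cint) (auto split: split_indicator)
  moreover have "measure unit_leb (e - e') = measure unit_leb e - h"
    using s e by (subst unit_leb.finite_measure_Diff) auto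
  ultimately have lo: "s * h \<le> ?L e'" and up: "?L (e - e') \<le> s * (measure unit_leb e - h)" by simp_all
  have "h * ?L (e - e') \<le> h * (s * (measure unit_leb e - h))"
    using up h by (intro mult_left_mono) auto
  also have "\<dots> = (measure unit_leb e - h) * (s * h)" by simp
  also have "\<dots> \<le> (measure unit_leb e - h) * ?L e'" using lo h by (intro mult_left_mono) auto
  finally have "h * ?L e \<le> measure unit_leb e * ?L e'" unfolding split by (simp add: algebra_simps)
  then show thesis using that s by auto
qed

section \<open>Equimeasurable functions\<close>

lemma abs_equimeasurable_sym: "abs_equimeasurable x y \<Longrightarrow> abs_equimeasurable y x"
  by (simp add: abs_equimeasurable_def)

text \<open>Equimeasurability says that the complements of the two distribution functions agree, and
  a distribution function determines its probability measure on the line.\<close>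

lemma abs_equimeasurable_distr_eq:
  assumes [measurable]: "x \<in> borel_measurable unit_leb" "y \<in> borel_measurable unit_leb"
    and eq: "abs_equimeasurable x y"
  shows "distr unit_leb borel (\<lambda>t. \<bar>x t\<bar>) = distr unit_leb borel (\<lambda>t. \<bar>y t\<bar>)"
proof (rule cdf_unique)
  have cdf: "cdf (distr unit_leb borel (\<lambda>t. \<bar>u t\<bar>)) s = 1 - measure unit_leb {t\<in>{0..1}. \<bar>u t\<bar> > s}"
    if [measurable]: "u \<in> borel_measurable unit_leb" for u s
  proof -
    have m: "{t\<in>space unit_leb. s < \<bar>u t\<bar>} \<in> sets unit_leb" by measurable
    have "cdf (distr unit_leb borel (\<lambda>t. \<bar>u t\<bar>)) s = measure unit_leb ((\<lambda>t. \<bar>u t\<bar>) -` {..s} \<inter> space unit_leb)"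
      unfolding cdf_def by (intro measure_distr) auto
    also have "(\<lambda>t. \<bar>u t\<bar>) -` {..s} \<inter> space unit_leb = space unit_leb - {t\<in>space unit_leb. s < \<bar>u t\<bar>}"
      by auto
    also have "measure unit_leb \<dots> = 1 - measure unit_leb {t\<in>space unit_leb. s < \<bar>u t\<bar>}"
      using m by (rule unit_leb.prob_compl)
    finally show ?thesis by (simp add: space_restrict_space)
  qed
  show "cdf (distr unit_leb borel (\<lambda>t. \<bar>x t\<bar>)) = cdf (distr unit_leb borel (\<lambda>t. \<bar>y t\<bar>))"
    using eq by (intro ext) (simp add: cdf abs_equimeasurable_def)
  show "real_distribution (distr unit_leb borel (\<lambda>t. \<bar>x t\<bar>))"
    by (rule unit_leb.real_distribution_distr) measurable
  show "real_distribution (distr unit_leb borel (\<lambda>t. \<bar>y t\<bar>))"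
    by (rule unit_leb.real_distribution_distr) measurable
qed

text \<open>\<open>s * h + (LINT t. max 0 (\<bar>x t\<bar> - s))\<close> bounds the integral of \<open>\<bar>x\<bar>\<close> over every set of measure
  \<open>h\<close> and only depends on the distribution of \<open>\<bar>x\<bar>\<close>; for the right \<open>s\<close> a level set attains it.\<close>

lemma abs_equimeasurable_L1_norm_indicator:
  assumes x: "x \<in> L1_space" and y [measurable]: "y \<in> borel_measurable unit_leb"
    and eq: "abs_equimeasurable y x"
  shows "y \<in> L1_space"
    and "e \<in> sets unit_leb \<Longrightarrow> 0 < measure unit_leb e \<Longrightarrow>
      \<exists>e'\<in>sets unit_leb. measure unit_leb e' = measure unit_leb e \<and>
        L1_norm (\<lambda>t. y t * indicator e t) \<le> L1_norm (\<lambda>t. x t * indicator e' t)"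
proof -
  have [measurable]: "x \<in> borel_measurable unit_leb" using x by (rule L1_space_measurable)
  have distr: "distr unit_leb borel (\<lambda>t. \<bar>y t\<bar>) = distr unit_leb borel (\<lambda>t. \<bar>x t\<bar>)"
    using eq by (intro abs_equimeasurable_distr_eq) auto
  have "integrable unit_leb (\<lambda>t. \<bar>x t\<bar>)" using x by (simp add: L1_space_def)
  then have "integrable (distr unit_leb borel (\<lambda>t. \<bar>x t\<bar>)) (\<lambda>r. r)"
    by (subst integrable_distr_eq) auto
  then have "integrable unit_leb (\<lambda>t. \<bar>y t\<bar>)"
    unfolding distr[symmetric] by (subst (asm) integrable_distr_eq) auto
  then show yL: "y \<in> L1_space" by (simp add: L1_space_def integrable_abs_iff)
  assume e: "e \<in> sets unit_leb" and pos: "0 < measure unit_leb e"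
  define h where "h = measure unit_leb e"
  obtain s e' where s: "0 \<le> s" "e' \<in> sets unit_leb" "e' \<subseteq> {0..1}" "measure unit_leb e' = h"
    "\<And>t. t \<in> e' \<Longrightarrow> s \<le> \<bar>x t\<bar>" "\<And>t. t \<in> {0..1} - e' \<Longrightarrow> \<bar>x t\<bar> \<le> s"
    using unit_leb_threshold_set[of "\<lambda>t. \<bar>x t\<bar>" "{0..1}" h] unit_interval_measure pos by (auto simp: h_def)
  have cint: "integrable unit_leb (\<lambda>t. s * indicator a t)" if "a \<in> sets unit_leb" for a
    using that by (intro integrable_mult_right integrable_real_indicator) (auto simp: unit_leb.emeasure_eq_measure)
  have const: "(LINT t|unit_leb. s * indicator a t) = s * measure unit_leb a" if "a \<in> sets unit_leb" for a
    using sets_unit_leb_subset[OF that] by (simp add: Int_absorb2)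
  have mint: "integrable unit_leb (\<lambda>t. max 0 (\<bar>u t\<bar> - s))" if "u \<in> L1_space" for u
    using that by (auto simp: L1_space_def)
  have "L1_norm (\<lambda>t. y t * indicator e t) \<le> (LINT t|unit_leb. s * indicator e t + max 0 (\<bar>y t\<bar> - s))"
    unfolding L1_norm_def using e yL
    by (intro integral_mono Bochner_Integration.integrable_add cint mint integrable_abs)
      (auto simp: L1_space_def intro: integrable_real_mult_indicator split: split_indicator)
  also have "\<dots> = s * h + (LINT t|unit_leb. max 0 (\<bar>y t\<bar> - s))"
    by (simp only: Bochner_Integration.integral_add[OF cint[OF e] mint[OF yL]] const[OF e] h_def)
  also have "(LINT t|unit_leb. max 0 (\<bar>y t\<bar> - s)) = (LINT r|distr unit_leb borel (\<lambda>t. \<bar>y t\<bar>). max 0 (r - s))"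
    by (subst integral_distr) auto
  also have "\<dots> = (LINT t|unit_leb. max 0 (\<bar>x t\<bar> - s))"
    unfolding distr by (subst integral_distr) auto
  also have "s * h + \<dots> = (LINT t|unit_leb. s * indicator e' t + max 0 (\<bar>x t\<bar> - s))"
    by (simp only: Bochner_Integration.integral_add[OF cint[OF s(2)] mint[OF x]] const[OF s(2)] s(4))
  \<comment> \<open>Equality holds because \<open>\<bar>x\<bar>\<close> is \<open>s\<close> plus its
    excess on \<open>e'\<close>, while the excess vanishes on the rest of the unit interval.\<close>
  also have "\<dots> = L1_norm (\<lambda>t. x t * indicator e' t)"
    unfolding L1_norm_def using s(5,6)
    by (intro Bochner_Integration.integral_cong) (auto split: split_indicator)
  finally show "\<exists>e'\<in>sets unit_leb. measure unit_leb e' = measure unit_leb e \<and>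
        L1_norm (\<lambda>t. y t * indicator e t) \<le> L1_norm (\<lambda>t. x t * indicator e' t)"
    using s(2,4) by (auto simp: h_def)
qed

text \<open>This is Fatou's lemma for \<open>\<bar>u m\<bar>\<close>. The bound is asked for only
  from \<open>K\<close> on, which is the form that a Cauchy condition supplies.\<close>

lemma L1_norm_Fatou:
  assumes u: "\<And>m. u m \<in> L1_space" and v [measurable]: "v \<in> borel_measurable unit_leb"
    and lim: "AE t in unit_leb. (\<lambda>m. u m t) \<longlonglongrightarrow> v t"
    and le: "\<And>m. K \<le> m \<Longrightarrow> L1_norm (u m) \<le> c" and c: "0 \<le> c"
  shows "v \<in> L1_space" "L1_norm v \<le> c"
proof -
  have [measurable]: "u m \<in> borel_measurable unit_leb" for m using u by (rule L1_space_measurable)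
  have "(\<integral>\<^sup>+t. ennreal \<bar>v t\<bar> \<partial>unit_leb) = (\<integral>\<^sup>+t. liminf (\<lambda>m. ennreal \<bar>u m t\<bar>) \<partial>unit_leb)"
  proof (rule nn_integral_cong_AE)
    show "AE t in unit_leb. ennreal \<bar>v t\<bar> = liminf (\<lambda>m. ennreal \<bar>u m t\<bar>)"
      using lim
    proof eventually_elim
      case (elim t)
      then have "(\<lambda>m. ennreal \<bar>u m t\<bar>) \<longlonglongrightarrow> ennreal \<bar>v t\<bar>" by (intro tendsto_intros)
      then show ?case by (intro lim_imp_Liminf[symmetric]) auto
    qed
  qed
  also have "\<dots> \<le> liminf (\<lambda>m. \<integral>\<^sup>+t. ennreal \<bar>u m t\<bar> \<partial>unit_leb)"
    by (rule nn_integral_liminf) measurable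
  also have "\<dots> \<le> ennreal c"
  proof (rule Liminf_le)
    show "\<forall>\<^sub>F m in sequentially. (\<integral>\<^sup>+t. ennreal \<bar>u m t\<bar> \<partial>unit_leb) \<le> ennreal c"
    proof (rule eventually_sequentiallyI[of K])
      fix m assume "K \<le> m"
      have "(\<integral>\<^sup>+t. ennreal \<bar>u m t\<bar> \<partial>unit_leb) = ennreal (L1_norm (u m))"
        unfolding L1_norm_def using u[of m] by (intro nn_integral_eq_integral) (auto simp: L1_space_def)
      then show "(\<integral>\<^sup>+t. ennreal \<bar>u m t\<bar> \<partial>unit_leb) \<le> ennreal c"
        using le[OF \<open>K \<le> m\<close>] by (simp add: ennreal_leI)
    qed
  qed simp
  finally have nn: "(\<integral>\<^sup>+t. ennreal \<bar>v t\<bar> \<partial>unit_leb) \<le> ennreal c" .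
  then have int: "integrable unit_leb v"
    by (intro integrableI_bounded) (auto intro: le_less_trans)
  then show "v \<in> L1_space" by (simp add: L1_space_def)
  have "ennreal (L1_norm v) = (\<integral>\<^sup>+t. ennreal \<bar>v t\<bar> \<partial>unit_leb)"
    unfolding L1_norm_def using int by (intro nn_integral_eq_integral[symmetric]) auto
  then have "ennreal (L1_norm v) \<le> ennreal c" using nn by simp
  then show "L1_norm v \<le> c" using c by (simp only: ennreal_le_iff)
qed

subsection \<open>Marcinkiewicz spaces\<close>

text \<open>For each \<open>h\<close> the supremum over sets of measure \<open>h\<close> is the
  integral over \<open>[0,h]\<close> of the decreasing rearrangement, so this is the classical
  Marcinkiewicz norm with weight \<open>w\<close>. Sets of measure zero are left out to avoid
  dividing by \<open>w 0\<close>, and \<open>bdd_above\<close> expresses that the real supremum is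
  finite.\<close>

definition marcinkiewicz_space :: "(real \<Rightarrow> real) \<Rightarrow> fun_space" where
  "marcinkiewicz_space w =
     ({x\<in>L1_space. bdd_above ((\<lambda>e. L1_norm (\<lambda>t. x t * indicator e t) / w (measure unit_leb e)) `
          {e\<in>sets unit_leb. 0 < measure unit_leb e})},
      \<lambda>x. SUP e\<in>{e\<in>sets unit_leb. 0 < measure unit_leb e}.
        L1_norm (\<lambda>t. x t * indicator e t) / w (measure unit_leb e))"

context
  fixes w :: "real \<Rightarrow> real" and E N
  \<comment> \<open>The first condition makes the weight positive and the norm of the unit indicator
    at most 1; the second makes the norm dominate the L1 norm, by taking \<open>{0..1}\<close> as
    the set.\<close>
  assumes w_ge: "\<And>h. 0 < h \<Longrightarrow> h \<le> 1 \<Longrightarrow> h \<le> w h" and w_1: "w 1 = 1"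
  defines "E \<equiv> fst (marcinkiewicz_space w)" and "N \<equiv> snd (marcinkiewicz_space w)"
begin

lemma marcinkiewicz_weight_pos: "0 < measure unit_leb e \<Longrightarrow> 0 < w (measure unit_leb e)"
  using w_ge[of "measure unit_leb e"] unit_leb.prob_le_1[of e] by linarith

lemma marcinkiewicz_spaceI:
  assumes x: "x \<in> L1_space"
    and le: "\<And>e. e \<in> sets unit_leb \<Longrightarrow> 0 < measure unit_leb e \<Longrightarrow>
      L1_norm (\<lambda>t. x t * indicator e t) \<le> c * w (measure unit_leb e)"
  shows "x \<in> E" "N x \<le> c"
proof -
  have q: "L1_norm (\<lambda>t. x t * indicator e t) / w (measure unit_leb e) \<le> c"
    if "e \<in> {e\<in>sets unit_leb. 0 < measure unit_leb e}" for e
    using le[of e] marcinkiewicz_weight_pos[of e] that by (simp add: divide_le_eq)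
  then show "x \<in> E" unfolding E_def marcinkiewicz_space_def using x by (auto intro!: bdd_aboveI2[of _ _ c])
  have "{e\<in>sets unit_leb. 0 < measure unit_leb e} \<noteq> {}" using unit_interval_measure by auto
  then show "N x \<le> c" unfolding N_def marcinkiewicz_space_def snd_conv using q by (rule cSUP_least)
qed

lemma marcinkiewicz_spaceD:
  assumes x: "x \<in> E" and e: "e \<in> sets unit_leb" "0 < measure unit_leb e"
  shows "L1_norm (\<lambda>t. x t * indicator e t) \<le> N x * w (measure unit_leb e)"
proof -
  have "L1_norm (\<lambda>t. x t * indicator e t) / w (measure unit_leb e) \<le> N x"
    unfolding N_def marcinkiewicz_space_def snd_conv
    using x e by (intro cSUP_upper) (auto simp: E_def marcinkiewicz_space_def)
  then show ?thesis using marcinkiewicz_weight_pos[OF e(2)] by (simp add: divide_le_eq)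
qed

lemma marcinkiewicz_space_L1: "x \<in> E \<Longrightarrow> x \<in> L1_space"
  by (simp add: E_def marcinkiewicz_space_def)

lemma L1_norm_le_marcinkiewicz: "x \<in> E \<Longrightarrow> L1_norm x \<le> N x"
  using marcinkiewicz_spaceD[of x "{0..1}"] unit_interval_measure by (simp add: w_1 L1_norm_indicator_unit)

lemma marcinkiewicz_nonneg: "x \<in> E \<Longrightarrow> 0 \<le> N x"
  using L1_norm_le_marcinkiewicz L1_norm_nonneg order_trans by blast

lemma marcinkiewicz_ideal:
  assumes x: "x \<in> E" and y: "y \<in> borel_measurable unit_leb" "AE t in unit_leb. \<bar>y t\<bar> \<le> \<bar>x t\<bar>"
  shows "y \<in> E" "N y \<le> N x"
proof -
  have xL: "x \<in> L1_space" using x by (rule marcinkiewicz_space_L1)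
  have yL: "y \<in> L1_space" using xL y by (rule L1_norm_mono_AE)
  have le: "L1_norm (\<lambda>t. y t * indicator e t) \<le> N x * w (measure unit_leb e)"
    if e: "e \<in> sets unit_leb" "0 < measure unit_leb e" for e
  proof -
    have "AE t in unit_leb. \<bar>y t * indicator e t\<bar> \<le> \<bar>x t * indicator e t\<bar>"
      using y(2) by eventually_elim (auto split: split_indicator)
    then have "L1_norm (\<lambda>t. y t * indicator e t) \<le> L1_norm (\<lambda>t. x t * indicator e t)"
      by (rule L1_norm_mono_AE(2)[OF L1_space_indicator[OF xL e(1)]
            L1_space_measurable[OF L1_space_indicator[OF yL e(1)]]])
    also have "\<dots> \<le> N x * w (measure unit_leb e)" using x e by (rule marcinkiewicz_spaceD)
    finally show ?thesis .
  qed
  show "y \<in> E" using yL le by (rule marcinkiewicz_spaceI)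
  show "N y \<le> N x" using yL le by (rule marcinkiewicz_spaceI)
qed

text \<open>Every set integral of \<open>\<bar>y\<bar>\<close> is dominated by one of
  \<open>\<bar>x\<bar>\<close> over a set of the same measure. This gives one inequality, and
  exchanging \<open>x\<close> and \<open>y\<close> gives the other.\<close>

lemma marcinkiewicz_rearrange:
  assumes x: "x \<in> E" and y: "y \<in> borel_measurable unit_leb" "abs_equimeasurable y x"
  shows "y \<in> E" "N y = N x"
proof -
  have *: "y \<in> E \<and> N y \<le> N x"
    if x: "x \<in> E" and y: "y \<in> borel_measurable unit_leb" "abs_equimeasurable y x" for x y
  proof -
    have xL: "x \<in> L1_space" using x by (rule marcinkiewicz_space_L1)
    have yL: "y \<in> L1_space" using xL y by (rule abs_equimeasurable_L1_norm_indicator)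
    have le: "L1_norm (\<lambda>t. y t * indicator e t) \<le> N x * w (measure unit_leb e)"
      if e: "e \<in> sets unit_leb" "0 < measure unit_leb e" for e
    proof -
      obtain e' where "e' \<in> sets unit_leb" "measure unit_leb e' = measure unit_leb e"
        "L1_norm (\<lambda>t. y t * indicator e t) \<le> L1_norm (\<lambda>t. x t * indicator e' t)"
        using abs_equimeasurable_L1_norm_indicator(2)[OF xL y e] by blast
      then show ?thesis using marcinkiewicz_spaceD[OF x, of e'] e by simp
    qed
    show ?thesis using marcinkiewicz_spaceI[OF yL le] by blast
  qed
  show "y \<in> E" using *[OF x y] by blast
  then show "N y = N x"
    using *[OF x y] *[of y x] x y marcinkiewicz_space_L1 L1_space_measurable abs_equimeasurable_sym
    by (intro antisym) blast+
qed

lemma marcinkiewicz_add: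
  assumes "x \<in> E" "y \<in> E"
  shows "(\<lambda>t. x t + y t) \<in> E" "N (\<lambda>t. x t + y t) \<le> N x + N y"
proof -
  have L: "x \<in> L1_space" "y \<in> L1_space" using assms marcinkiewicz_space_L1 by auto
  have le: "L1_norm (\<lambda>t. (x t + y t) * indicator e t) \<le> (N x + N y) * w (measure unit_leb e)"
    if e: "e \<in> sets unit_leb" "0 < measure unit_leb e" for e
    using L1_norm_triangle[OF L1_space_indicator[OF L(1) e(1)] L1_space_indicator[OF L(2) e(1)]]
      marcinkiewicz_spaceD[OF assms(1) e] marcinkiewicz_spaceD[OF assms(2) e]
    by (simp add: distrib_right)
  show "(\<lambda>t. x t + y t) \<in> E" "N (\<lambda>t. x t + y t) \<le> N x + N y"
    using marcinkiewicz_spaceI[OF L1_space_add[OF L] le] by blast+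
qed

text \<open>Only the upper estimate is proved directly; for nonzero \<open>a\<close> the lower one
  follows by scaling back with \<open>inverse a\<close>.\<close>

lemma marcinkiewicz_scale:
  assumes "x \<in> E"
  shows "(\<lambda>t. a * x t) \<in> E" "N (\<lambda>t. a * x t) = \<bar>a\<bar> * N x"
proof -
  have *: "(\<lambda>t. a * x t) \<in> E \<and> N (\<lambda>t. a * x t) \<le> \<bar>a\<bar> * N x" if x: "x \<in> E" for a x
  proof -
    have le: "L1_norm (\<lambda>t. a * x t * indicator e t) \<le> \<bar>a\<bar> * N x * w (measure unit_leb e)"
      if e: "e \<in> sets unit_leb" "0 < measure unit_leb e" for e
      using L1_norm_scale[of a "\<lambda>t. x t * indicator e t"] marcinkiewicz_spaceD[OF x e]
      by (simp add: mult.assoc mult_left_mono)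
    show ?thesis
      using marcinkiewicz_spaceI[OF L1_space_scale[OF marcinkiewicz_space_L1[OF x]] le] by blast
  qed
  show E: "(\<lambda>t. a * x t) \<in> E" using *[OF assms] by blast
  show "N (\<lambda>t. a * x t) = \<bar>a\<bar> * N x"
  proof (cases "a = 0")
    case True
    then show ?thesis using *[OF assms, of 0] marcinkiewicz_nonneg[of "\<lambda>t. 0"] by simp
  next
    case False
    then have "N x \<le> \<bar>inverse a\<bar> * N (\<lambda>t. a * x t)"
      using *[OF E, of "inverse a"] by (simp add: mult.assoc[symmetric])
    then have "\<bar>a\<bar> * N x \<le> N (\<lambda>t. a * x t)"
      using False by (simp add: field_simps)
    then show ?thesis using *[OF assms, of a] by simp
  qed
qed

lemma marcinkiewicz_zero_iff:
  assumes x: "x \<in> E"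
  shows "N x = 0 \<longleftrightarrow> (AE t in unit_leb. x t = 0)"
proof
  have xL: "x \<in> L1_space" using x by (rule marcinkiewicz_space_L1)
  assume "N x = 0"
  then have "L1_norm x = 0" using L1_norm_le_marcinkiewicz[OF x] L1_norm_nonneg[of x] by simp
  then show "AE t in unit_leb. x t = 0" using L1_norm_eq_0_iff[OF xL] by blast
next
  have xL: "x \<in> L1_space" using x by (rule marcinkiewicz_space_L1)
  assume "AE t in unit_leb. x t = 0"
  then have "L1_norm x = 0" using L1_norm_eq_0_iff[OF xL] by blast
  then have "N x \<le> 0"
    using L1_norm_indicator_le[OF xL] by (intro marcinkiewicz_spaceI[OF xL]) auto
  then show "N x = 0" using marcinkiewicz_nonneg[OF x] by simp
qed

lemma marcinkiewicz_indicator_unit: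
  "indicator {0..1} \<in> E" "N (indicator {0..1}) = 1"
proof -
  have L: "indicator {0..1} \<in> L1_space" using unit_interval_measure
    by (simp add: L1_space_def unit_leb.emeasure_eq_measure integrable_real_indicator)
  have norm: "L1_norm (\<lambda>t. indicator {0..1} t * indicator e t) = measure unit_leb e"
    if "e \<in> sets unit_leb" for e
  proof -
    have "L1_norm (\<lambda>t. indicator {0..1} t * indicator e t) = (LINT t|unit_leb. indicator e t)"
      unfolding L1_norm_def
      by (intro Bochner_Integration.integral_cong) (auto split: split_indicator)
    then show ?thesis using sets_unit_leb_subset[OF that] by (simp add: Int_absorb2)
  qed
  have le: "L1_norm (\<lambda>t. indicator {0..1} t * indicator e t) \<le> 1 * w (measure unit_leb e)"
    if "e \<in> sets unit_leb" "0 < measure unit_leb e" for e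
    using w_ge[OF that(2)] unit_leb.prob_le_1[of e] by (simp add: norm[OF that(1)])
  show E: "indicator {0..1} \<in> E" using L le by (rule marcinkiewicz_spaceI)
  have "L1_norm (indicator {0..1}) = 1"
    using norm[OF unit_interval_measure(1)] unit_interval_measure(2) by (simp only: L1_norm_indicator_unit)
  then show "N (indicator {0..1}) = 1"
    using marcinkiewicz_spaceI(2)[OF L le] L1_norm_le_marcinkiewicz[OF E] by simp
qed

text \<open>A Cauchy sequence is also Cauchy in L1, so a subsequence converges almost everywhere.
  Fatou's lemma on each set \<open>e\<close> passes the Cauchy estimate to this pointwise
  limit.\<close>

lemma marcinkiewicz_complete:
  assumes X: "\<And>n. X n \<in> E"
    and cauchy: "\<And>r. 0 < r \<Longrightarrow> \<exists>K::nat. \<forall>m\<ge>K. \<forall>n\<ge>K. N (\<lambda>t. X m t - X n t) < r"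
  shows "\<exists>x\<in>E. (\<lambda>n. N (\<lambda>t. X n t - x t)) \<longlonglongrightarrow> 0"
proof -
  have XL: "X n \<in> L1_space" for n using X by (rule marcinkiewicz_space_L1)
  have diff: "(\<lambda>t. x t - y t) \<in> E" if "x \<in> E" "y \<in> E" for x y
    using marcinkiewicz_add(1)[OF that(1) marcinkiewicz_scale(1)[OF that(2), of "-1"]] by simp
  have [measurable]: "X n \<in> borel_measurable unit_leb" for n using XL by (rule L1_space_measurable)
  have int: "integrable unit_leb (X n)" for n using XL by (simp add: L1_space_def)
  have "\<exists>K. \<forall>i\<ge>K. \<forall>j\<ge>K. (LINT t|unit_leb. norm (X i t - X j t)) < r" if r: "0 < r" for r
  proof -
    obtain K where "\<forall>m\<ge>K. \<forall>n\<ge>K. N (\<lambda>t. X m t - X n t) < r" using cauchy[OF r] by blast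
    then have "\<forall>m\<ge>K. \<forall>n\<ge>K. L1_norm (\<lambda>t. X m t - X n t) < r"
      using L1_norm_le_marcinkiewicz[OF diff[OF X X]] le_less_trans by blast
    then show ?thesis by (auto simp: L1_norm_def)
  qed
  from cauchy_L1_AE_cauchy_subseq[OF int this]
  obtain r :: "nat \<Rightarrow> nat" where r: "strict_mono r" "AE t in unit_leb. Cauchy (\<lambda>i. X (r i) t)"
    by blast
  \<comment> \<open>Where the subsequence diverges \<open>lim\<close> is an unspecified value, but
    this concerns a null set only.\<close>
  define x where "x t = lim (\<lambda>i. X (r i) t)" for t
  have x_meas [measurable]: "x \<in> borel_measurable unit_leb"
    unfolding x_def by measurable
  have x_lim: "AE t in unit_leb. (\<lambda>i. X (r i) t) \<longlonglongrightarrow> x t"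
    using r(2) by eventually_elim (simp add: x_def Cauchy_convergent_iff convergent_LIMSEQ_iff)
  have near: "(\<lambda>t. X n t - x t) \<in> E \<and> N (\<lambda>t. X n t - x t) \<le> c"
    if K: "\<And>m n. K \<le> m \<Longrightarrow> K \<le> n \<Longrightarrow> N (\<lambda>t. X m t - X n t) < c" and c: "0 < c" and n: "K \<le> n" for K c n
  proof -
    have part: "(\<lambda>t. (X n t - x t) * indicator e t) \<in> L1_space \<and>
        L1_norm (\<lambda>t. (X n t - x t) * indicator e t) \<le> c * w (measure unit_leb e)"
      if e: "e \<in> sets unit_leb" "0 < measure unit_leb e" for e
    proof -
      have wpos: "0 < w (measure unit_leb e)" using e(2) by (rule marcinkiewicz_weight_pos)
      have uL: "(\<lambda>t. (X n t - X (r m) t) * indicator e t) \<in> L1_space" for m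
        by (intro L1_space_indicator L1_space_diff XL e)
      have meas: "(\<lambda>t. (X n t - x t) * indicator e t) \<in> borel_measurable unit_leb"
        using e(1) by measurable
      have lim: "AE t in unit_leb. (\<lambda>m. (X n t - X (r m) t) * indicator e t) \<longlonglongrightarrow> (X n t - x t) * indicator e t"
        using x_lim by eventually_elim (intro tendsto_intros)
      have le: "L1_norm (\<lambda>t. (X n t - X (r m) t) * indicator e t) \<le> c * w (measure unit_leb e)"
        if "K \<le> m" for m
      proof -
        \<comment> \<open>The index \<open>n\<close> stays fixed while the other one runs along the
          subsequence, which never falls behind its own index.\<close>
        have "K \<le> r m" using seq_suble[OF r(1), of m] that by simp
        have "L1_norm (\<lambda>t. (X n t - X (r m) t) * indicator e t) \<le>
            N (\<lambda>t. X n t - X (r m) t) * w (measure unit_leb e)"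
          using diff[OF X X] e by (rule marcinkiewicz_spaceD)
        also have "\<dots> \<le> c * w (measure unit_leb e)"
          using K[OF n \<open>K \<le> r m\<close>] wpos by (intro mult_right_mono) auto
        finally show ?thesis .
      qed
      have c0: "0 \<le> c * w (measure unit_leb e)" using c wpos by simp
      show ?thesis using L1_norm_Fatou[OF uL meas lim le c0] by blast
    qed
    have "(\<lambda>t. (X n t - x t) * indicator {0..1} t) \<in> L1_space"
      using part[of "{0..1}"] unit_interval_measure by simp
    moreover have "integrable unit_leb (\<lambda>t. (X n t - x t) * indicator {0..1} t) \<longleftrightarrow>
        integrable unit_leb (\<lambda>t. X n t - x t)"
      by (intro Bochner_Integration.integrable_cong) auto
    ultimately have "(\<lambda>t. X n t - x t) \<in> L1_space" by (simp add: L1_space_def)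
    then show ?thesis using marcinkiewicz_spaceI[of "\<lambda>t. X n t - x t" c] part by blast
  qed
  obtain K where "\<And>m n. K \<le> m \<Longrightarrow> K \<le> n \<Longrightarrow> N (\<lambda>t. X m t - X n t) < 1"
    using cauchy[of 1] by auto
  then have "(\<lambda>t. X K t - x t) \<in> E" using near[of K 1 K] by auto
  \<comment> \<open>Here \<open>x\<close> is written as \<open>X K - (X K - x)\<close>.\<close>
  from diff[OF X this, of K] have xE: "x \<in> E" by simp
  have "(\<lambda>n. N (\<lambda>t. X n t - x t)) \<longlonglongrightarrow> 0"
  proof (rule LIMSEQ_I)
    fix c :: real assume "0 < c"
    then obtain K where "\<And>m n. K \<le> m \<Longrightarrow> K \<le> n \<Longrightarrow> N (\<lambda>t. X m t - X n t) < c / 2"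
      using cauchy[of "c / 2"] by auto
    then have "N (\<lambda>t. X n t - x t) \<le> c / 2" if "K \<le> n" for n
      using near[of K "c / 2" n] that \<open>0 < c\<close> by auto
    then show "\<exists>K. \<forall>n\<ge>K. norm (N (\<lambda>t. X n t - x t) - 0) < c"
      using \<open>0 < c\<close> marcinkiewicz_nonneg[OF diff[OF X xE]]
      by (intro exI[of _ K]) (fastforce intro: le_less_trans)
  qed
  then show ?thesis using xE by blast
qed

lemma symmetric_marcinkiewicz_space: "symmetric_space (marcinkiewicz_space w)"
proof -
  have zero: "(\<lambda>t. 0) \<in> E" using marcinkiewicz_scale(1)[OF marcinkiewicz_indicator_unit(1), of 0] by simp
  have "linear_function_space E"
    unfolding linear_function_space_def using zero marcinkiewicz_add(1) marcinkiewicz_scale(1) by blast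
  then have "banach_function_space (E, N)"
    unfolding banach_function_space_def prod.case
    using marcinkiewicz_space_L1 L1_space_measurable marcinkiewicz_nonneg marcinkiewicz_zero_iff
      marcinkiewicz_scale(2) marcinkiewicz_add(2) marcinkiewicz_complete
    by (intro conjI subsetI ballI allI impI) blast+
  moreover have "(E, N) = marcinkiewicz_space w" by (simp add: E_def N_def)
  moreover have "fundamental_function (E, N) 1 = 1"
    using marcinkiewicz_indicator_unit by (simp add: fundamental_function_def)
  ultimately have "symmetric_space (E, N)"
    unfolding symmetric_space_def prod.case
    using marcinkiewicz_ideal marcinkiewicz_rearrange marcinkiewicz_indicator_unit(1)
    by (intro conjI ballI impI) blast+
  then show ?thesis using \<open>(E, N) = marcinkiewicz_space w\<close> by simp
qed

end

subsection \<open>The boundary space\<close>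

context
  fixes B :: "(real \<Rightarrow> real) set"
  assumes closed: "closed_subspace_L1 B" and nontrivial: "\<exists>x\<in>B. \<not> (AE t in unit_leb. x t = 0)"
begin

section \<open>Properties of \<open>eta\<close> on a nontrivial subspace\<close>

lemma subspace_L1: "x \<in> B \<Longrightarrow> x \<in> L1_space"
  using closed by (auto simp: closed_subspace_L1_def)

lemma subspace_scale: "x \<in> B \<Longrightarrow> (\<lambda>t. a * x t) \<in> B"
  using closed by (simp add: closed_subspace_L1_def linear_function_space_def)

lemma subspace_unit_vector: obtains x where "x \<in> B" "L1_norm x = 1"
proof -
  obtain x where x: "x \<in> B" "\<not> (AE t in unit_leb. x t = 0)" using nontrivial by blast
  then have "L1_norm x \<noteq> 0" using L1_norm_eq_0_iff[OF subspace_L1] by blast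
  then have "L1_norm (\<lambda>t. inverse (L1_norm x) * x t) = 1"
    using L1_norm_nonneg[of x] by (simp add: L1_norm_scale)
  then show thesis using that subspace_scale[OF x(1)] by blast
qed

lemma eta_inner_bdd:
  assumes "x \<in> B" "L1_norm x = 1"
  shows "bdd_above ((\<lambda>e. L1_norm (\<lambda>t. x t * indicator e t)) ` {e\<in>sets unit_leb. measure unit_leb e = h})"
  using L1_norm_indicator_le[OF subspace_L1[OF assms(1)]] assms(2) by (intro bdd_aboveI2[of _ _ 1]) auto

text \<open>Both suprema range over nonempty sets: nontriviality of \<open>B\<close> gives a unit
  vector, and \<open>h \<le> 1\<close> gives a set of measure \<open>h\<close>. Hence a common upper
  bound passes to each of them.\<close>

lemma eta_le:
  assumes h: "0 < h" "h \<le> 1"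
    and le: "\<And>x e. x \<in> B \<Longrightarrow> L1_norm x = 1 \<Longrightarrow> e \<in> sets unit_leb \<Longrightarrow> measure unit_leb e = h \<Longrightarrow>
      L1_norm (\<lambda>t. x t * indicator e t) \<le> c"
  shows "eta B h \<le> c"
proof -
  obtain x where "x \<in> B" "L1_norm x = 1" by (rule subspace_unit_vector)
  then have "{x\<in>B. L1_norm x = 1} \<noteq> {}" by blast
  then have "(SUP x\<in>{x\<in>B. L1_norm x = 1}.
        SUP e\<in>{e\<in>sets unit_leb. measure unit_leb e = h}. L1_norm (\<lambda>t. x t * indicator e t)) \<le> c"
    using sets_of_measure_nonempty[of h] h le by (intro cSUP_least) auto
  then show ?thesis using h by (simp add: eta_def)
qed

text \<open>Restriction to a set does not increase the L1 norm, so 1 bounds both the inner and the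
  outer supremum, and each of them dominates its members.\<close>

lemma L1_norm_indicator_le_eta:
  assumes x: "x \<in> B" "L1_norm x = 1" and e: "e \<in> sets unit_leb" "0 < measure unit_leb e"
  shows "L1_norm (\<lambda>t. x t * indicator e t) \<le> eta B (measure unit_leb e)"
proof -
  let ?h = "measure unit_leb e"
  let ?M = "{e\<in>sets unit_leb. measure unit_leb e = ?h}"
  let ?I = "\<lambda>x. SUP e\<in>?M. L1_norm (\<lambda>t. x t * indicator e t)"
  have "?I y \<le> 1" if "y \<in> {y\<in>B. L1_norm y = 1}" for y
  proof (rule cSUP_least)
    show "?M \<noteq> {}" using e by blast
    show "L1_norm (\<lambda>t. y t * indicator a t) \<le> 1" if "a \<in> ?M" for a
      using L1_norm_indicator_le[OF subspace_L1, of y a] \<open>y \<in> {y\<in>B. L1_norm y = 1}\<close> that by auto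
  qed
  then have bdd: "bdd_above (?I ` {y\<in>B. L1_norm y = 1})" by (rule bdd_aboveI2)
  have "L1_norm (\<lambda>t. x t * indicator e t) \<le> ?I x"
    using e by (intro cSUP_upper eta_inner_bdd x) auto
  also have "\<dots> \<le> (SUP x\<in>{x\<in>B. L1_norm x = 1}. ?I x)"
    using x bdd by (intro cSUP_upper) auto
  also have "\<dots> = eta B ?h" using e(2) by (simp add: eta_def)
  finally show ?thesis .
qed

lemma L1_norm_indicator_le_eta_times:
  assumes x: "x \<in> B" and e: "e \<in> sets unit_leb" "0 < measure unit_leb e"
  shows "L1_norm (\<lambda>t. x t * indicator e t) \<le> L1_norm x * eta B (measure unit_leb e)"
proof (cases "L1_norm x = 0")
  case True
  then show ?thesis using L1_norm_indicator_le[OF subspace_L1[OF x] e(1)] by simp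
next
  case False
  then have pos: "0 < L1_norm x" using L1_norm_nonneg[of x] by simp
  have "L1_norm (\<lambda>t. inverse (L1_norm x) * x t) = 1" using pos by (simp add: L1_norm_scale)
  from L1_norm_indicator_le_eta[OF subspace_scale[OF x] this e]
  have "inverse (L1_norm x) * L1_norm (\<lambda>t. x t * indicator e t) \<le> eta B (measure unit_leb e)"
    using L1_norm_scale[of "inverse (L1_norm x)" "\<lambda>t. x t * indicator e t"] pos
    by (simp add: mult.assoc)
  then show ?thesis using pos by (simp add: field_simps)
qed

text \<open>For each \<open>x\<close>, a set of measure \<open>k\<close> can be replaced by one of
  measure \<open>h\<close> on which the mean of \<open>\<bar>x\<bar>\<close> is at least as large.
  This is the monotonicity of \<open>h / eta B h\<close>, cleared of denominators.\<close>

lemma eta_antimono_ratio: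
  assumes h: "0 < h" "h \<le> k" "k \<le> 1"
  shows "h * eta B k \<le> k * eta B h"
proof -
  have "eta B k \<le> k * eta B h / h"
  proof (rule eta_le)
    fix x e assume x: "x \<in> B" "L1_norm x = 1" and e: "e \<in> sets unit_leb" "measure unit_leb e = k"
    obtain e' where e': "e' \<in> sets unit_leb" "measure unit_leb e' = h"
      "h * L1_norm (\<lambda>t. x t * indicator e t) \<le> k * L1_norm (\<lambda>t. x t * indicator e' t)"
      using L1_norm_indicator_concentrate[OF subspace_L1[OF x(1)] e(1), of h] h e(2) by auto
    have "L1_norm (\<lambda>t. x t * indicator e' t) \<le> eta B h"
      using L1_norm_indicator_le_eta[OF x e'(1)] e'(2) h by simp
    then have "k * L1_norm (\<lambda>t. x t * indicator e' t) \<le> k * eta B h"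
      using h by (intro mult_left_mono) auto
    with e'(3) have "h * L1_norm (\<lambda>t. x t * indicator e t) \<le> k * eta B h" by (rule order_trans)
    then show "L1_norm (\<lambda>t. x t * indicator e t) \<le> k * eta B h / h"
      using h by (simp add: field_simps)
  qed (use h in auto)
  then show ?thesis using h by (simp add: field_simps)
qed

lemma eta_1: "eta B 1 = 1"
proof (rule antisym)
  show "eta B 1 \<le> 1"
  proof (rule eta_le)
    fix x e assume "x \<in> B" "L1_norm x = 1" "e \<in> sets unit_leb"
    then show "L1_norm (\<lambda>t. x t * indicator e t) \<le> 1"
      using L1_norm_indicator_le[OF subspace_L1, of x e] by simp
  qed auto
  obtain x where x: "x \<in> B" "L1_norm x = 1" by (rule subspace_unit_vector)
  have m: "measure unit_leb {0..1} = 1" by (subst measure_unit_leb_interval) auto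
  then have "L1_norm (\<lambda>t. x t * indicator {0..1} t) \<le> eta B (measure unit_leb {0..1})"
    by (intro L1_norm_indicator_le_eta x interval_in_sets_unit_leb) auto
  then show "1 \<le> eta B 1" unfolding m L1_norm_indicator_unit x(2) .
qed

text \<open>Comparing the ratios at \<open>h\<close> and at 1 makes \<open>eta B\<close> an
  admissible weight for the Marcinkiewicz space; it also makes \<open>eta B h\<close>
  positive.\<close>

lemma eta_ge: "0 < h \<Longrightarrow> h \<le> 1 \<Longrightarrow> h \<le> eta B h"
  using eta_antimono_ratio[of h 1] by (simp add: eta_1)

lemma eta_star_eq:
  assumes "0 < \<tau>" "\<tau> \<le> 1"
  shows "eta_star B \<tau> = \<tau> / eta B \<tau>"
  unfolding eta_star_def
proof (rule cSup_eq_maximum)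
  show "\<tau> / eta B \<tau> \<in> (\<lambda>h. h / eta B h) ` {0<..\<tau>}" using assms by auto
  fix r assume "r \<in> (\<lambda>h. h / eta B h) ` {0<..\<tau>}"
  then obtain h where h: "0 < h" "h \<le> \<tau>" and r: "r = h / eta B h" by auto
  then have "0 < eta B h" "0 < eta B \<tau>" using eta_ge[of h] eta_ge[of \<tau>] assms by auto
  then show "r \<le> \<tau> / eta B \<tau>"
    unfolding r using eta_antimono_ratio[of h \<tau>] h assms by (simp add: field_simps)
qed

section \<open>Upper bound over the transfer class\<close>

text \<open>\<open>LEAST\<close> over the reals says nothing until a minimum exists. The infimum of
  the admissible constants is itself admissible, since it dominates every quotient of the two norms
  on \<open>B\<close>; it is positive by the lower transfer estimate at a unit vector.\<close>

lemma transfer_const: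
  assumes S: "S \<in> transfer_class B"
  shows "0 < transfer_const B S" "x \<in> B \<Longrightarrow> snd S x \<le> transfer_const B S * L1_norm x"
proof -
  obtain E N where EN: "S = (E, N)" by (cases S)
  define C where "C = {c. \<forall>x\<in>B. N x \<le> c * L1_norm x}"
  obtain k where k: "1 \<le> k" "\<forall>x\<in>B. inverse k * L1_norm x \<le> N x \<and> N x \<le> k * L1_norm x"
    using S by (auto simp: EN transfer_class_def can_transfer_def)
  then have kC: "k \<in> C" by (simp add: C_def)
  obtain u where u: "u \<in> B" "L1_norm u = 1" by (rule subspace_unit_vector)
  then have "N u \<le> c" if "c \<in> C" for c using that by (auto simp: C_def)
  then have bdd: "bdd_below C" by (rule bdd_belowI)
  have Inf_C: "N x \<le> Inf C * L1_norm x" if x: "x \<in> B" for x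
  proof (cases "L1_norm x = 0")
    case True
    then show ?thesis using k(2) x by auto
  next
    case False
    then have pos: "0 < L1_norm x" using L1_norm_nonneg[of x] by simp
    have "N x / L1_norm x \<le> Inf C"
    proof (rule cInf_greatest)
      show "C \<noteq> {}" using kC by blast
      show "N x / L1_norm x \<le> c" if "c \<in> C" for c
        using that x pos by (simp add: C_def divide_le_eq)
    qed
    then show ?thesis using pos by (simp add: divide_le_eq)
  qed
  have eq: "transfer_const B S = Inf C"
    unfolding transfer_const_def EN snd_conv
  proof (rule Least_equality)
    show "\<forall>x\<in>B. N x \<le> Inf C * L1_norm x" using Inf_C by blast
    show "Inf C \<le> c" if "\<forall>x\<in>B. N x \<le> c * L1_norm x" for c
      using that bdd by (intro cInf_lower) (auto simp: C_def)
  qed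
  show "snd S x \<le> transfer_const B S * L1_norm x" if "x \<in> B"
    using Inf_C[OF that] unfolding eq by (simp add: EN)
  have "0 < inverse k" using k(1) by simp
  also have "\<dots> \<le> N u" using k(2) u by force
  also have "\<dots> \<le> Inf C" using Inf_C[OF u(1)] u(2) by simp
  finally show "0 < transfer_const B S" by (simp add: eq)
qed

lemma triple_norm_indicator_le:
  assumes S: "S \<in> transfer_class B" and \<tau>: "0 < \<tau>" "\<tau> \<le> 1"
  shows "triple_norm B S (indicator {0..\<tau>}) \<le> \<tau> / eta B \<tau>"
proof -
  obtain E N where EN: "S = (E, N)" by (cases S)
  have sym: "symmetric_space (E, N)" and BE: "B \<subseteq> E"
    using S by (auto simp: EN transfer_class_def can_transfer_def)
  let ?\<phi> = "fundamental_function (E, N) \<tau>" and ?c = "transfer_const B S"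
  have I: "{0..\<tau>} \<in> sets unit_leb" "measure unit_leb {0..\<tau>} = \<tau>"
    using \<tau> by (auto simp: interval_in_sets_unit_leb measure_unit_leb_interval)
  have pos: "0 < eta B \<tau>" using eta_ge[OF \<tau>] \<tau> by simp
  have c: "0 < ?c" using S by (rule transfer_const)
  have phi0: "0 \<le> ?\<phi>"
    unfolding fundamental_function_def snd_conv
    by (intro symmetric_space_nonneg[OF sym] symmetric_space_indicator[OF sym] I)
  \<comment> \<open>The averaging inequality is applied to unit vectors of \<open>B\<close>, where
    \<open>N x \<le> ?c\<close>, before taking the supremum. The case of vanishing
    \<open>?\<phi>\<close> is split off to allow division.\<close>
  have "?\<phi> * eta B \<tau> \<le> \<tau> * ?c"
  proof (cases "?\<phi> = 0")
    case True
    then show ?thesis using \<tau> c by simp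
  next
    case False
    then have phi: "0 < ?\<phi>" using phi0 by simp
    have "eta B \<tau> \<le> \<tau> * ?c / ?\<phi>"
    proof (rule eta_le[OF \<tau>])
      fix x e assume x: "x \<in> B" "L1_norm x = 1" and e: "e \<in> sets unit_leb" "measure unit_leb e = \<tau>"
      have "?\<phi> * L1_norm (\<lambda>t. x t * indicator e t) \<le> \<tau> * N x"
        using x BE subspace_L1 by (intro fundamental_function_times_L1_norm_le[OF sym] e \<tau>) auto
      also have "\<dots> \<le> \<tau> * ?c"
        using transfer_const(2)[OF S x(1)] x(2) \<tau> by (intro mult_left_mono) (auto simp: EN)
      finally show "L1_norm (\<lambda>t. x t * indicator e t) \<le> \<tau> * ?c / ?\<phi>"
        using phi by (simp add: field_simps)
    qed
    then show ?thesis using phi by (simp add: field_simps)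
  qed
  then have "inverse ?c * snd S (indicator {0..\<tau>}) \<le> \<tau> / eta B \<tau>"
    using pos c by (simp add: EN fundamental_function_def field_simps)
  moreover have "L1_norm (indicator {0..\<tau>}) = \<tau>"
    using \<tau> I by (simp add: L1_norm_def Int_absorb2)
  \<comment> \<open>This handles the L1 term in the maximum defining
    \<open>triple_norm\<close>.\<close>
  moreover have "\<tau> \<le> \<tau> / eta B \<tau>"
  proof -
    have "eta B \<tau> \<le> 1"
    proof (rule eta_le[OF \<tau>])
      fix x e assume "x \<in> B" "L1_norm x = 1" "e \<in> sets unit_leb"
      then show "L1_norm (\<lambda>t. x t * indicator e t) \<le> 1"
        using L1_norm_indicator_le[OF subspace_L1, of x e] by simp
    qed
    then show ?thesis using pos \<tau> by (simp add: field_simps)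
  qed
  ultimately show ?thesis by (simp add: triple_norm_def)
qed

section \<open>The extremal Marcinkiewicz space\<close>

text \<open>On \<open>B\<close> each set integral is at most the L1 norm times \<open>eta B\<close>,
  so every quotient in the supremum is at most the L1 norm; the set \<open>{0..1}\<close> attains
  it.\<close>

lemma marcinkiewicz_norm_eq_L1_norm:
  assumes "x \<in> B"
  shows "x \<in> fst (marcinkiewicz_space (eta B))" "snd (marcinkiewicz_space (eta B)) x = L1_norm x"
proof -
  show x: "x \<in> fst (marcinkiewicz_space (eta B))"
    by (rule marcinkiewicz_spaceI(1)[OF eta_ge eta_1 subspace_L1[OF assms]
          L1_norm_indicator_le_eta_times[OF assms]])
  show "snd (marcinkiewicz_space (eta B)) x = L1_norm x"
  proof (rule antisym)
    show "snd (marcinkiewicz_space (eta B)) x \<le> L1_norm x"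
      by (rule marcinkiewicz_spaceI(2)[OF eta_ge eta_1 subspace_L1[OF assms]
            L1_norm_indicator_le_eta_times[OF assms]])
    show "L1_norm x \<le> snd (marcinkiewicz_space (eta B)) x"
      by (rule L1_norm_le_marcinkiewicz[OF eta_ge eta_1 x])
  qed
qed

lemma marcinkiewicz_in_transfer_class: "marcinkiewicz_space (eta B) \<in> transfer_class B"
proof -
  have "can_transfer B (marcinkiewicz_space (eta B))"
    unfolding can_transfer_def case_prod_beta
    using marcinkiewicz_norm_eq_L1_norm by (auto intro!: exI[of _ 1])
  moreover have "symmetric_space (marcinkiewicz_space (eta B))"
    using eta_ge eta_1 by (rule symmetric_marcinkiewicz_space)
  ultimately show ?thesis by (simp add: transfer_class_def)
qed

lemma transfer_const_marcinkiewicz: "transfer_const B (marcinkiewicz_space (eta B)) = 1"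
  unfolding transfer_const_def
proof (rule Least_equality)
  show "\<forall>x\<in>B. snd (marcinkiewicz_space (eta B)) x \<le> 1 * L1_norm x"
    using marcinkiewicz_norm_eq_L1_norm by simp
  obtain x where x: "x \<in> B" "L1_norm x = 1" by (rule subspace_unit_vector)
  show "1 \<le> c" if "\<forall>x\<in>B. snd (marcinkiewicz_space (eta B)) x \<le> c * L1_norm x" for c
    using that x marcinkiewicz_norm_eq_L1_norm(2)[OF x(1)] by force
qed

text \<open>The set \<open>{0..\<tau>}\<close> itself serves as test set in the supremum, and the
  transfer constant of this space is 1.\<close>

lemma triple_norm_marcinkiewicz_indicator:
  assumes \<tau>: "0 < \<tau>" "\<tau> \<le> 1"
  shows "\<tau> / eta B \<tau> \<le> triple_norm B (marcinkiewicz_space (eta B)) (indicator {0..\<tau>})"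
proof -
  let ?i = "indicator {0..\<tau>} :: real \<Rightarrow> real"
  have I: "{0..\<tau>} \<in> sets unit_leb" "measure unit_leb {0..\<tau>} = \<tau>"
    using \<tau> by (auto simp: interval_in_sets_unit_leb measure_unit_leb_interval)
  have sym: "symmetric_space (fst (marcinkiewicz_space (eta B)), snd (marcinkiewicz_space (eta B)))"
    using marcinkiewicz_in_transfer_class by (simp add: transfer_class_def)
  have "?i \<in> fst (marcinkiewicz_space (eta B))"
    using sym I(1) by (rule symmetric_space_indicator)
  then have "L1_norm (\<lambda>t. ?i t * ?i t) \<le> snd (marcinkiewicz_space (eta B)) ?i * eta B (measure unit_leb {0..\<tau>})"
    using I \<tau> by (intro marcinkiewicz_spaceD[OF eta_ge eta_1]) auto
  moreover have "L1_norm (\<lambda>t. ?i t * ?i t) = \<tau>"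
  proof -
    have "L1_norm (\<lambda>t. ?i t * ?i t) = (LINT t|unit_leb. ?i t)"
      unfolding L1_norm_def by (intro Bochner_Integration.integral_cong) (auto split: split_indicator)
    also have "\<dots> = \<tau>" using \<tau> I by (simp add: Int_absorb2)
    finally show ?thesis .
  qed
  moreover have "0 < eta B \<tau>" using eta_ge[OF \<tau>] \<tau> by simp
  ultimately show ?thesis
    by (simp add: I(2) triple_norm_def transfer_const_marcinkiewicz field_simps le_max_iff_disj)
qed

end

theorem theorem2:
  fixes B :: "(real \<Rightarrow> real) set" and \<tau> :: real
  assumes "closed_subspace_L1 B"
    and "\<exists>x\<in>B. \<not> (AE t in unit_leb. x t = 0)"
    and "reflexive_space B L1_norm"
    and "0 < \<tau>" and "\<tau> \<le> 1"
  shows "indicator {0..\<tau>} \<in> fst (boundary_space B) \<and>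
         fundamental_function (boundary_space B) \<tau> = eta_star B \<tau> \<and>
         eta_star B \<tau> = (SUP h\<in>{0<..\<tau>}. h / eta B \<tau>)"
proof (intro conjI)
  note B = assms(1,2) and \<tau> = assms(4,5)
  let ?T = "transfer_class B" and ?M = "marcinkiewicz_space (eta B)"
  let ?i = "indicator {0..\<tau>} :: real \<Rightarrow> real"
  have le: "triple_norm B S ?i \<le> \<tau> / eta B \<tau>" if "S \<in> ?T" for S
    using that \<tau> by (rule triple_norm_indicator_le[OF B])
  have bdd: "bdd_above ((\<lambda>S. triple_norm B S ?i) ` ?T)" using le by (rule bdd_aboveI2)
  have "?i \<in> fst S" if "S \<in> ?T" for S
  proof -
    have "symmetric_space (fst S, snd S)" using that by (simp add: transfer_class_def)
    then show ?thesis
      by (rule symmetric_space_indicator) (use \<tau> in \<open>auto intro: interval_in_sets_unit_leb\<close>)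
  qed
  then show "?i \<in> fst (boundary_space B)" using bdd by (simp add: boundary_space_def)
  have M: "?M \<in> ?T" using B by (rule marcinkiewicz_in_transfer_class)
  \<comment> \<open>The upper bound is common to the whole class, and the Marcinkiewicz space
    \<open>?M\<close> attains it.\<close>
  have "(SUP S\<in>?T. triple_norm B S ?i) = \<tau> / eta B \<tau>"
  proof (rule antisym)
    show "(SUP S\<in>?T. triple_norm B S ?i) \<le> \<tau> / eta B \<tau>"
      using M le by (intro cSUP_least) auto
    show "\<tau> / eta B \<tau> \<le> (SUP S\<in>?T. triple_norm B S ?i)"
      using triple_norm_marcinkiewicz_indicator[OF B \<tau>] cSUP_upper[OF M bdd] by (rule order_trans)
  qed
  then show "fundamental_function (boundary_space B) \<tau> = eta_star B \<tau>"
    using eta_star_eq[OF B \<tau>] by (simp add: fundamental_function_def boundary_space_def)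
  have "0 < eta B \<tau>" using eta_ge[OF B \<tau>] \<tau> by simp
  \<comment> \<open>With the denominator fixed at \<open>\<tau>\<close> the quotient is linear in
    \<open>h\<close>, so its maximum is at \<open>h = \<tau>\<close>, where it agrees with the
    quotient in \<open>eta_star\<close>.\<close>
  then have "(SUP h\<in>{0<..\<tau>}. h / eta B \<tau>) = \<tau> / eta B \<tau>"
    using \<tau> by (intro cSup_eq_maximum) (auto simp: divide_right_mono)
  then show "eta_star B \<tau> = (SUP h\<in>{0<..\<tau>}. h / eta B \<tau>)"
    using eta_star_eq[OF B \<tau>] by simp
qed

end
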